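(* Let $K\in\mathbb R$, $N\in(1,\infty)$, $D\in(0,\infty)$, and let $h$ be an $\mathrm{MCP}(K,N)$ density with $\operatorname{diam}(\operatorname{supp}h)\le D$. Then the following estimate holds: $$\lambda[h]\ge\begin{cases}\lambda[h_{K,N,D}] & \text{if }K\le0,\\ \inf_{D'\in(0,\min(D,D_{K,N})]}\lambda[h_{K,N,D'}] & \text{if }K>0,\end{cases}$$ and it is sharp (the right-hand side cannot be replaced by a larger constant depending only on $K,N,D$).
   Context: For $\kappa\in\mathbb R$: $s_\kappa(\theta)=\frac1{\sqrt\kappa}\sin(\sqrt\kappa\,\theta)$ for $\theta\in[0,\pi/\sqrt\kappa]$ if $\kappa>0$; $s_0(\theta)=\theta$; $s_\kappa(\theta)=\frac1{\sqrt{-\kappa}}\sinh(\sqrt{-\kappa}\,\theta)$ if $\kappa<0$. $D_{K,N}:=\pi/\sqrt{K/(N-1)}$ if $K>0$ and $D_{K,N}:=+\infty$ otherwise. For $t\in[0,1]$, $\theta\ge0$: $\sigma^{(t)}_{K,N-1}(\theta):=+\infty$ if $\theta\ge D_{K,N}$ and $\sigma^{(t)}_{K,N-1}(\theta):=\frac{s_{K/(N-1)}(t\theta)}{s_{K/(N-1)}(\theta)}$ otherwise (interpreted as $t$ at $\theta=0$). A non-negative $h\in L^1_{loc}(\mathbb R)$ is an $\mathrm{MCP}(K,N)$ density if $h(tx_1+(1-t)x_0)\ge\sigma^{(1-t)}_{K,N-1}(|x_1-x_0|)^{N-1}h(x_0)$ for all $x_0,x_1\in\operatorname{supp}h$ and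 $t\in[0,1]$ (with $\infty\cdot0=0$), where $\operatorname{supp}h$ denotes the support of the measure $h\,dx$, assumed to be of positive diameter. For finite $D\in(0,D_{K,N}]$, $h_{K,N,D}(x)=s_{K/(N-1)}(D-x)^{N-1}$ for $x\in[0,D/2]$, $h_{K,N,D}(x)=s_{K/(N-1)}(x)^{N-1}$ for $x\in[D/2,D]$, and $0$ outside $[0,D]$. For a non-negative density $h$ on $\mathbb R$, $$\lambda[h]:=\inf\Big\{\frac{\int_{\mathbb R}|f'|^2h\,dx}{\int_{\mathbb R} f^2h\,dx}: f:\mathbb R\to\mathbb R\text{ locally Lipschitz},\ \int fh\,dx=0,\ 0<\int f^2h\,dx<\infty\Big\}.$$ *)

theory Defs
  imports "HOL-Analysis.Analysis"
begin

text \<open>For \<open>\<kappa> > 0\<close> the function is only ever used on \<open>[0, pi / sqrt \<kappa>]\<close>;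
  elsewhere the formula is kept as a total extension.\<close>

definition s_fun :: "real \<Rightarrow> real \<Rightarrow> real" where
  "s_fun \<kappa> \<theta> =
     (if \<kappa> > 0 then sin (sqrt \<kappa> * \<theta>) / sqrt \<kappa>
      else if \<kappa> = 0 then \<theta>
      else sinh (sqrt (- \<kappa>) * \<theta>) / sqrt (- \<kappa>))"

definition D_max :: "real \<Rightarrow> real \<Rightarrow> ereal" where
  "D_max K N = (if K > 0 then ereal (pi / sqrt (K / (N - 1))) else \<infinity>)"

text \<open>\<open>sigma_coeff K N t \<theta>\<close> is $\sigma^{(t)}_{K,N-1}(\theta)$: the argument \<open>N\<close> stands for
  the subscript $N-1$. For \<open>t\<close> in \<open>[0, 1]\<close> and \<open>0 \<le> \<theta> < D_max K N\<close> the quotient is non-negative,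
  so the truncation performed by \<open>ennreal\<close> has no effect.\<close>

definition sigma_coeff :: "real \<Rightarrow> real \<Rightarrow> real \<Rightarrow> real \<Rightarrow> ennreal" where
  "sigma_coeff K N t \<theta> =
     (if ereal \<theta> \<ge> D_max K N then \<infinity>
      else if \<theta> = 0 then ennreal t
      else ennreal (s_fun (K / (N - 1)) (t * \<theta>) / s_fun (K / (N - 1)) \<theta>))"

text \<open>Real powers on $[0,\infty]$, for positive exponents only.\<close>

definition ennreal_powr :: "ennreal \<Rightarrow> real \<Rightarrow> ennreal" where
  "ennreal_powr x p = (if x = \<infinity> then \<infinity> else ennreal (enn2real x powr p))"

definition density_supp :: "(real \<Rightarrow> real) \<Rightarrow> real set" where
  "density_supp h =
     {x. \<forall>U. open U \<and> x \<in> U \<longrightarrow> emeasure (density lebesgue (\<lambda>y. ennreal (h y))) U > 0}"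

text \<open>The density is a pointwise-defined function, as the inequality is required at every
  pair of points of the support. The product is taken in \<open>ennreal\<close>, where \<open>\<infinity> * 0 = 0\<close>.
  Positive diameter is stated as the existence of two distinct points, since the support may be
  unbounded and \<^const>\<open>diameter\<close> is only meaningful on bounded sets.\<close>

definition MCP_density :: "real \<Rightarrow> real \<Rightarrow> (real \<Rightarrow> real) \<Rightarrow> bool" where
  "MCP_density K N h \<longleftrightarrow>
     (\<forall>x. 0 \<le> h x) \<and>
     (\<forall>C. compact C \<longrightarrow> h absolutely_integrable_on C) \<and>
     (\<exists>x\<in>density_supp h. \<exists>y\<in>density_supp h. x \<noteq> y) \<and>
     (\<forall>x0\<in>density_supp h. \<forall>x1\<in>density_supp h. \<forall>t\<in>{0..1}.
        ennreal (h (t * x1 + (1 - t) * x0)) \<ge>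
          ennreal_powr (sigma_coeff K N (1 - t) \<bar>x1 - x0\<bar>) (N - 1) * ennreal (h x0))"

definition h_model :: "real \<Rightarrow> real \<Rightarrow> real \<Rightarrow> real \<Rightarrow> real" where
  "h_model K N D x =
     (if 0 \<le> x \<and> x \<le> D / 2 then s_fun (K / (N - 1)) (D - x) powr (N - 1)
      else if D / 2 \<le> x \<and> x \<le> D then s_fun (K / (N - 1)) x powr (N - 1)
      else 0)"

definition locally_lipschitz :: "(real \<Rightarrow> real) \<Rightarrow> bool" where
  "locally_lipschitz f \<longleftrightarrow> (\<forall>x. \<exists>u>0. \<exists>L. L-lipschitz_on (cball x u) f)"

text \<open>By Rademacher's theorem \<open>deriv f\<close> is the derivative of \<open>f\<close> outside a null set, and
  its unspecified values on that null set do not affect the integral. The numerator may be infinite,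
  and \<open>\<integral> f h = 0\<close> includes integrability of \<open>f h\<close>.\<close>

definition spectral_gap :: "(real \<Rightarrow> real) \<Rightarrow> ennreal" where
  "spectral_gap h =
     (INF f \<in> {f. locally_lipschitz f \<and>
                  has_bochner_integral lebesgue (\<lambda>x. f x * h x) 0 \<and>
                  0 < (\<integral>\<^sup>+x. ennreal ((f x)\<^sup>2 * h x) \<partial>lebesgue) \<and>
                  (\<integral>\<^sup>+x. ennreal ((f x)\<^sup>2 * h x) \<partial>lebesgue) < \<infinity>}.
        (\<integral>\<^sup>+x. ennreal (\<bar>deriv f x\<bar>\<^sup>2 * h x) \<partial>lebesgue) /
        (\<integral>\<^sup>+x. ennreal ((f x)\<^sup>2 * h x) \<partial>lebesgue))"

end

theory Submission
  imports Defs
begin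

text \<open>Let \<open>w = s\<^sup>N\<^sup>-\<^sup>1\<close> be the model density on the right half \<open>(D/2, D)\<close>, and \<open>\<lambda>\<close> the model
  gap. Odd reflection turns \<open>u\<close> with \<open>u (D/2) = 0\<close> into a test function for the model, whence
  \<open>\<lambda> \<integral> u\<^sup>2 w \<le> \<integral> u'\<^sup>2 w\<close> on \<open>(D/2, D)\<close>; freezing \<open>u\<close> beyond \<open>y\<close> gives the same inequality on
  \<open>(D/2, y)\<close> for every \<open>y\<close>. Contracting the support \<open>[a, b]\<close> of an MCP density \<open>h\<close> towards an endpoint
  shows that on each half of the support, suitably rescaled when \<open>K \<le> 0\<close> and \<open>b - a < D\<close>, \<open>h\<close> is
  \<open>w\<close> times an antitone weight. An antitone weight is a mixture of indicators of initial intervals,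
  so integrating over its levels transfers the inequality to \<open>h\<close>. It is applied on both halves
  to \<open>f - f m\<close>, with \<open>m\<close> the midpoint of the support, so no eigenfunctions are needed.\<close>

section \<open>Generalised sine functions\<close>

text \<open>Ptolemy's identity for four points on a line, in all three curvatures at once:
  product-to-sum formulas settle the sine and expansion into exponentials the hyperbolic sine. It is
  what makes the model density satisfy the MCP inequality: the difference of the two sides to be
  compared becomes a single product.\<close>

lemma s_fun_ptolemy:
  "s_fun k (b - a) * s_fun k (d - c) - s_fun k (b - c) * s_fun k (d - a)
    = s_fun k (c - a) * s_fun k (d - b)"
proof -
  have trig: "sin (B - A) * sin (D - C) - sin (B - C) * sin (D - A) = sin (C - A) * sin (D - B)"
    for A B C D :: real
  proof -
    have 1: "sin (B - A) * sin (D - C) = (cos (B - A - D + C) - cos (B - A + D - C)) / 2"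
      by (simp add: sin_times_sin algebra_simps)
    have 2: "sin (B - C) * sin (D - A) = (cos (B - C - D + A) - cos (B - C + D - A)) / 2"
      by (simp add: sin_times_sin algebra_simps)
    have 3: "sin (C - A) * sin (D - B) = (cos (C - A - D + B) - cos (C - A + D - B)) / 2"
      by (simp add: sin_times_sin algebra_simps)
    have 4: "cos (C - A + D - B) = cos (B - C - D + A)"
      by (metis cos_minus add_uminus_conv_diff minus_diff_eq minus_add_distrib add.commute diff_diff_eq2 diff_add_eq)
    have 5: "cos (B - A - D + C) = cos (C - A - D + B)" by (rule arg_cong[of _ _ cos]) simp
    have 6: "cos (B - C + D - A) = cos (B - A + D - C)" by (rule arg_cong[of _ _ cos]) simp
    show ?thesis unfolding 1 2 3 4 5 6 by (simp add: diff_divide_distrib)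
  qed
  have hyp: "sinh (B - A) * sinh (D - C) - sinh (B - C) * sinh (D - A) = sinh (C - A) * sinh (D - B)"
    for A B C D :: real
  proof -
    have e: "exp (x - y) = exp x * inverse (exp y)" for x y :: real
      by (simp add: exp_diff divide_inverse)
    show ?thesis
      by (simp add: sinh_field_def e exp_minus field_simps)
  qed
  show ?thesis
    using trig[of "sqrt k * b" "sqrt k * a" "sqrt k * d" "sqrt k * c"]
      hyp[of "sqrt (-k) * b" "sqrt (-k) * a" "sqrt (-k) * d" "sqrt (-k) * c"]
    unfolding s_fun_def by (auto simp: field_simps)
qed

lemma s_fun_minus [simp]: "s_fun k (- x) = - s_fun k x"
  by (simp add: s_fun_def)

lemma s_fun_0 [simp]: "s_fun k 0 = 0"
  by (simp add: s_fun_def)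

lemma continuous_on_s_fun: "continuous_on A (s_fun k)"
  unfolding s_fun_def by (cases "k > 0"; cases "k = 0") (auto intro!: continuous_intros)

lemma s_fun_borel [measurable]: "s_fun k \<in> borel_measurable borel"
  by (intro borel_measurable_continuous_onI continuous_on_s_fun)

section \<open>Sign and monotonicity of the generalised sine\<close>

lemma s_fun_pos:
  assumes "1 < N" "0 < x" "ereal x < D_max K N"
  shows "0 < s_fun (K / (N - 1)) x"
proof (cases "K > 0")
  case True
  then have k: "K / (N - 1) > 0" using assms by simp
  have "x * sqrt (K / (N - 1)) < pi"
    using assms True k by (simp add: D_max_def pos_less_divide_eq)
  then show ?thesis using k assms(2) by (auto simp: s_fun_def mult.commute intro!: divide_pos_pos sin_gt_zero)
next
  case False
  then have "\<not> K / (N - 1) > 0" "K / (N - 1) < 0 \<or> K = 0" using assms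
    by (auto simp: field_simps zero_less_mult_iff divide_neg_pos)
  then show ?thesis using assms by (auto simp: s_fun_def)
qed

lemma s_fun_D_max:
  assumes "1 < N" "ereal x = D_max K N"
  shows "s_fun (K / (N - 1)) x = 0"
  using assms by (auto simp: D_max_def s_fun_def split: if_splits)

lemma s_fun_nonneg:
  assumes "1 < N" "0 \<le> x" "ereal x \<le> D_max K N"
  shows "0 \<le> s_fun (K / (N - 1)) x"
  using s_fun_pos[of N x K] s_fun_D_max[of N x K] assms
  by (cases "x = 0"; cases "ereal x = D_max K N") (auto simp: order_less_le)

text \<open>For \<open>K > 0\<close> the sine increases only up to a quarter period. The bound on
  \<open>u + v\<close> keeps the mean of the two angles below \<open>pi / 2\<close>, so both factors
  in the sum-to-product formula are non-negative. The pair \<open>x\<close>, \<open>D - x\<close>,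
  whose sum is \<open>D\<close>, satisfies this bound.\<close>

lemma s_fun_mono:
  assumes "1 < N" "0 \<le> u" "u \<le> v" "ereal (u + v) \<le> D_max K N"
  shows "s_fun (K / (N - 1)) u \<le> s_fun (K / (N - 1)) v"
proof (cases "K > 0")
  case True
  then have k: "K / (N - 1) > 0" using assms by simp
  define r where "r = sqrt (K / (N - 1))"
  have r: "r > 0" using k by (simp add: r_def)
  have "(u + v) * r \<le> pi"
    using assms True r by (simp add: D_max_def pos_le_divide_eq r_def)
  then have uv: "r * u + r * v \<le> pi" by (simp add: algebra_simps)
  have uv': "0 \<le> r * u" "r * u \<le> r * v" using r assms by auto
  have "sin (r * v) - sin (r * u) = 2 * sin ((r * v - r * u) / 2) * cos ((r * v + r * u) / 2)"
    by (rule sin_diff_sin)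
  also have "\<dots> \<ge> 0" using uv uv'
    by (intro mult_nonneg_nonneg sin_ge_zero cos_ge_zero) auto
  finally show ?thesis using k r by (simp add: s_fun_def r_def[symmetric] divide_right_mono)
next
  case False
  then have "\<not> K / (N - 1) > 0" using assms by (auto simp: field_simps zero_less_mult_iff)
  then show ?thesis using assms
    by (auto simp: s_fun_def intro!: divide_right_mono mult_left_mono)
qed

text \<open>The quotient \<open>sinh (c * t) / sinh t\<close> decreases in \<open>t\<close>: the
  numerator of its derivative is \<open>- ?\<phi> t\<close>, where \<open>?\<phi>\<close> vanishes
  at 0 and has derivative \<open>(1 - c\<^sup>2) * (sinh (c * t) * sinh t)\<close>, which is
  non-negative.\<close>

lemma sinh_scale:
  fixes c x y :: real
  assumes c: "0 < c" "c \<le> 1" and xy: "0 < x" "x \<le> y"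
  shows "sinh x * sinh (c * y) \<le> sinh (c * x) * sinh y"
proof -
  let ?\<phi> = "\<lambda>t. sinh (c * t) * cosh t - c * cosh (c * t) * sinh t"
  have nn: "?\<phi> t \<ge> 0" if "t \<ge> 0" for t
  proof -
    have "?\<phi> 0 \<le> ?\<phi> t"
    proof (rule DERIV_nonneg_imp_nondecreasing[OF that])
      fix s :: real assume s: "0 \<le> s" "s \<le> t"
      have d: "(?\<phi> has_real_derivative (1 - c\<^sup>2) * (sinh (c * s) * sinh s)) (at s)"
        by (auto intro!: derivative_eq_intros simp: power2_eq_square algebra_simps)
      have "0 \<le> (1 - c\<^sup>2) * (sinh (c * s) * sinh s)"
        using s c by (intro mult_nonneg_nonneg) (auto simp: power_le_one)
      with d show "\<exists>y. (?\<phi> has_real_derivative y) (at s) \<and> 0 \<le> y" by blast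
    qed
    then show ?thesis by simp
  qed
  have "sinh (c * y) / sinh y \<le> sinh (c * x) / sinh x"
  proof (rule DERIV_nonpos_imp_nonincreasing[OF xy(2)])
    fix s assume s: "x \<le> s" "s \<le> y"
    have sp: "sinh s > 0" using s xy by simp
    have d: "((\<lambda>t. sinh (c * t) / sinh t) has_real_derivative (- ?\<phi> s) / (sinh s * sinh s)) (at s)"
      using sp by (auto intro!: derivative_eq_intros simp: algebra_simps)
    have "(- ?\<phi> s) / (sinh s * sinh s) \<le> 0"
      using nn[of s] s xy by (intro divide_nonpos_nonneg) auto
    with d show "\<exists>y. ((\<lambda>t. sinh (c * t) / sinh t) has_real_derivative y) (at s) \<and> y \<le> 0" by blast
  qed
  moreover have "sinh x > 0" "sinh y > 0" using xy by auto
  ultimately show ?thesis by (simp add: field_simps)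
qed

lemma s_fun_scale:
  assumes k: "k \<le> 0 \<or> c = 1" and c: "0 < c" "c \<le> 1" and xy: "0 < x" "x \<le> y"
  shows "s_fun k x * s_fun k (c * y) \<le> s_fun k (c * x) * s_fun k y"
proof (cases "c = 1")
  case False
  then have "k \<le> 0" using k by simp
  moreover have "sinh (sqrt (-k) * x) * sinh (c * (sqrt (-k) * y))
      \<le> sinh (c * (sqrt (-k) * x)) * sinh (sqrt (-k) * y)" if "k < 0"
    using that xy by (intro sinh_scale c) (auto intro: mult_left_mono)
  ultimately show ?thesis
    by (auto simp: s_fun_def field_simps)
qed simp

section \<open>Derivatives and locally Lipschitz functions\<close>

text \<open>The Cauchy criterion for difference quotients, with outer quantifiers over natural
  numbers. No limit value occurs in it, so it exhibits the set of points of differentiability by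
  countable set operations.\<close>

lemma has_real_derivative_iff_Cauchy:
  fixes f :: "real \<Rightarrow> real"
  shows "(\<exists>D. (f has_real_derivative D) (at x)) \<longleftrightarrow>
    (\<forall>k::nat. \<exists>j::nat. \<forall>y z. y \<noteq> 0 \<and> z \<noteq> 0 \<and> \<bar>y\<bar> < inverse (Suc j) \<and> \<bar>z\<bar> < inverse (Suc j) \<longrightarrow>
       \<bar>(f (x + y) - f x) / y - (f (x + z) - f x) / z\<bar> \<le> inverse (Suc k))"
    (is "?L \<longleftrightarrow> ?R")
proof
  let ?q = "\<lambda>y. (f (x + y) - f x) / y"
  assume ?L
  then obtain D where D: "?q \<midarrow>0\<rightarrow> D" by (auto simp: DERIV_def)
  show ?R
  proof
    fix k :: nat
    have "0 < inverse (real (Suc k)) / 2" by simp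
    from LIM_D[OF D this] obtain s where s: "s > 0"
      "\<And>y. y \<noteq> 0 \<and> \<bar>y\<bar> < s \<Longrightarrow> \<bar>?q y - D\<bar> < inverse (real (Suc k)) / 2" by auto
    from reals_Archimedean[OF s(1)] obtain j where j: "inverse (real (Suc j)) < s" by blast
    show "\<exists>j::nat. \<forall>y z. y \<noteq> 0 \<and> z \<noteq> 0 \<and> \<bar>y\<bar> < inverse (Suc j) \<and> \<bar>z\<bar> < inverse (Suc j) \<longrightarrow>
       \<bar>?q y - ?q z\<bar> \<le> inverse (Suc k)"
    proof (intro exI allI impI)
      fix y z :: real
      assume "y \<noteq> 0 \<and> z \<noteq> 0 \<and> \<bar>y\<bar> < inverse (Suc j) \<and> \<bar>z\<bar> < inverse (Suc j)"
      then show "\<bar>?q y - ?q z\<bar> \<le> inverse (Suc k)"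
        using s(2)[of y] s(2)[of z] j by linarith
    qed
  qed
next
  let ?q = "\<lambda>y. (f (x + y) - f x) / y"
  assume R: ?R
  \<comment> \<open>A candidate for the derivative comes from one sequence of increments; the Cauchy
    condition then extends the convergence to all increments.\<close>
  define a where "a n = ?q (inverse (real (Suc n)))" for n
  have "Cauchy a"
  proof (rule metric_CauchyI)
    fix e :: real assume "0 < e"
    from reals_Archimedean[OF this] obtain k where k: "inverse (real (Suc k)) < e" by blast
    from R obtain j where j: "\<And>y z. y \<noteq> 0 \<and> z \<noteq> 0 \<and> \<bar>y\<bar> < inverse (Suc j) \<and> \<bar>z\<bar> < inverse (Suc j) \<Longrightarrow>
       \<bar>?q y - ?q z\<bar> \<le> inverse (Suc k)" by blast
    have "dist (a m) (a n) < e" if "m \<ge> Suc j" "n \<ge> Suc j" for m n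
      unfolding dist_real_def a_def using j[of "inverse (Suc m)" "inverse (Suc n)"] that k
      by (auto simp del: of_nat_Suc)
    then show "\<exists>M. \<forall>m\<ge>M. \<forall>n\<ge>M. dist (a m) (a n) < e" by blast
  qed
  then obtain D where D: "a \<longlonglongrightarrow> D" by (meson Cauchy_convergent_iff convergent_def)
  have "?q \<midarrow>0\<rightarrow> D"
  proof (rule LIM_I)
    fix e :: real assume "0 < e"
    from reals_Archimedean[OF this] obtain k where k: "inverse (real (Suc k)) < e" by blast
    from R obtain j where j: "\<And>y z. y \<noteq> 0 \<and> z \<noteq> 0 \<and> \<bar>y\<bar> < inverse (Suc j) \<and> \<bar>z\<bar> < inverse (Suc j) \<Longrightarrow>
       \<bar>?q y - ?q z\<bar> \<le> inverse (Suc k)" by blast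
    have "norm (?q y - D) < e" if y: "y \<noteq> 0 \<and> norm (y - 0) < inverse (Suc j)" for y
    proof -
      have "(\<lambda>n. \<bar>?q y - a n\<bar>) \<longlonglongrightarrow> \<bar>?q y - D\<bar>" by (intro tendsto_intros D)
      moreover have "\<bar>?q y - a n\<bar> \<le> inverse (Suc k)" if "n \<ge> Suc j" for n
        unfolding a_def using that y by (intro j) (auto simp del: of_nat_Suc)
      ultimately have "\<bar>?q y - D\<bar> \<le> inverse (Suc k)" by (intro LIMSEQ_le_const2) auto
      with k show ?thesis by simp
    qed
    then show "\<exists>s>0. \<forall>y. y \<noteq> 0 \<and> norm (y - 0) < s \<longrightarrow> norm (?q y - D) < e"
      by (intro exI[of _ "inverse (real (Suc j))"]) auto
  qed
  then show ?L by (auto simp: DERIV_def)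
qed

text \<open>By continuity of \<open>f\<close>, the Cauchy condition for fixed \<open>k\<close> and
  \<open>j\<close> defines a closed set \<open>A k j\<close>, so the differentiability set
  \<open>S\<close> is Borel. On \<open>S\<close> the derivative is a limit of continuous
  quotients.\<close>

lemma borel_measurable_deriv:
  fixes f :: "real \<Rightarrow> real"
  assumes f: "continuous_on UNIV f"
  shows "deriv f \<in> borel_measurable borel"
proof -
  define S where "S = {x. \<exists>D. (f has_real_derivative D) (at x)}"
  define A where "A k j = {x. \<forall>y z. y \<noteq> 0 \<and> z \<noteq> 0 \<and> \<bar>y\<bar> < inverse (Suc j) \<and> \<bar>z\<bar> < inverse (Suc j) \<longrightarrow>
       \<bar>(f (x + y) - f x) / y - (f (x + z) - f x) / z\<bar> \<le> inverse (Suc k)}" for k j :: nat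
  have cf: "continuous_on UNIV (\<lambda>x. f (x + y))" for y
    by (rule continuous_on_compose2[OF f]) (auto intro!: continuous_intros)
  have "closed (A k j)" for k j
  proof -
    have "closed {x. \<bar>(f (x + y) - f x) / y - (f (x + z) - f x) / z\<bar> \<le> inverse (Suc k)}"
      if "y \<noteq> 0" "z \<noteq> 0" for y z
      using that by (intro closed_Collect_le continuous_intros cf f) auto
    moreover have "A k j = (\<Inter>y\<in>{y. y \<noteq> 0 \<and> \<bar>y\<bar> < inverse (Suc j)}. \<Inter>z\<in>{z. z \<noteq> 0 \<and> \<bar>z\<bar> < inverse (Suc j)}.
        {x. \<bar>(f (x + y) - f x) / y - (f (x + z) - f x) / z\<bar> \<le> inverse (Suc k)})"
      unfolding A_def by blast
    ultimately show ?thesis by (auto intro!: closed_INT)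
  qed
  then have "A k j \<in> sets borel" for k j by (simp add: borel_closed)
  moreover have "S = (\<Inter>k. \<Union>j. A k j)"
    unfolding S_def A_def has_real_derivative_iff_Cauchy by auto
  ultimately have S [measurable]: "S \<in> sets borel" by auto
  define q where "q n x = (f (x + inverse (Suc n)) - f x) / inverse (Suc n)" for n :: nat and x
  have q [measurable]: "q n \<in> borel_measurable borel" for n
    unfolding q_def
    by (intro borel_measurable_continuous_onI continuous_intros cf f) auto
  \<comment> \<open>Off \<open>S\<close> no number satisfies the defining property of
    \<open>deriv\<close>, so its value there is one and the same unspecified constant.\<close>
  have "deriv f x = (if x \<in> S then lim (\<lambda>n. q n x) else (SOME D. False))" for x
  proof (cases "x \<in> S")
    case True
    then obtain D where D: "(f has_real_derivative D) (at x)" by (auto simp: S_def)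
    have "filterlim (\<lambda>n. inverse (real (Suc n))) (at 0) sequentially"
      unfolding filterlim_at using LIMSEQ_inverse_real_of_nat by auto
    from filterlim_compose[OF D[unfolded DERIV_def] this]
    have "(\<lambda>n. q n x) \<longlonglongrightarrow> D" by (simp add: q_def)
    then show ?thesis using D True by (simp add: limI DERIV_imp_deriv)
  next
    case False
    then show ?thesis by (auto simp: S_def deriv_def)
  qed
  then have "deriv f = (\<lambda>x. if x \<in> S then lim (\<lambda>n. q n x) else (SOME D. False))" by blast
  then show ?thesis by simp
qed

text \<open>At points of non-differentiability both sides are the same unspecified value.\<close>

lemma abs_deriv_affine_le:
  fixes f :: "real \<Rightarrow> real"
  assumes r: "r \<noteq> 0" and q: "q \<noteq> 0" and rq: "\<bar>r * q\<bar> \<le> 1"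
  shows "\<bar>deriv (\<lambda>x. r * f (p + q * x) + c) x\<bar> \<le> \<bar>deriv f (p + q * x)\<bar>"
proof (cases "\<exists>D. (f has_real_derivative D) (at (p + q * x))")
  case True
  then obtain D where D: "(f has_real_derivative D) (at (p + q * x))" by blast
  have "((\<lambda>x. r * f (p + q * x) + c) has_real_derivative r * (D * q) + 0) (at x)"
    by (intro DERIV_add DERIV_const DERIV_cmult DERIV_chain2[where f=f and g="\<lambda>x. p + q * x", OF D])
      (auto intro!: derivative_eq_intros)
  then have "\<bar>deriv (\<lambda>x. r * f (p + q * x) + c) x\<bar> = \<bar>r * q\<bar> * \<bar>D\<bar>"
    by (simp add: DERIV_imp_deriv abs_mult)
  also have "\<dots> \<le> 1 * \<bar>D\<bar>" using rq by (intro mult_right_mono) auto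
  finally show ?thesis using D by (simp add: DERIV_imp_deriv)
next
  case False
  let ?g = "\<lambda>x. r * f (p + q * x) + c"
  have "\<not> (\<exists>D. (?g has_real_derivative D) (at x))"
  proof
    assume "\<exists>D. (?g has_real_derivative D) (at x)"
    then obtain D where D: "(?g has_real_derivative D) (at ((p + q * x - p) / q))" using q by auto
    \<comment> \<open>Inverting both affine maps recovers \<open>f\<close>, so differentiability of
      the composite would imply that of \<open>f\<close>.\<close>
    have "((\<lambda>y. inverse r * (?g ((y - p) / q) - c)) has_real_derivative inverse r * (D * (1 / q) - 0)) (at (p + q * x))"
      by (intro DERIV_cmult DERIV_diff DERIV_const
          DERIV_chain2[where f="?g" and g="\<lambda>y. (y - p) / q", OF D])
        (auto intro!: derivative_eq_intros simp: q)
    moreover have "(\<lambda>y. inverse r * (?g ((y - p) / q) - c)) = f" using r q by (auto simp: fun_eq_iff)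
    ultimately show False using False by auto
  qed
  then show ?thesis using False by (simp add: deriv_def)
qed

section \<open>Operations on locally Lipschitz functions\<close>

lemma locally_lipschitz_compose:
  assumes f: "locally_lipschitz f" and g: "M-lipschitz_on UNIV g"
  shows "locally_lipschitz (\<lambda>x. f (g x))"
  unfolding locally_lipschitz_def
proof
  fix x
  from f obtain u L where u: "u > 0" and L: "L-lipschitz_on (cball (g x) u) f"
    unfolding locally_lipschitz_def by blast
  have M: "M \<ge> 0" using g by (rule lipschitz_on_nonneg)
  \<comment> \<open>The summand 1 keeps the denominator positive when \<open>M = 0\<close>.\<close>
  define e where "e = u / (M + 1)"
  have e: "e > 0" "M * e \<le> u" using u M by (auto simp: e_def field_simps)
  have "g ` cball x e \<subseteq> cball (g x) u"
  proof safe
    fix y assume "y \<in> cball x e"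
    then have "dist (g x) (g y) \<le> M * e"
      using lipschitz_onD[OF g, of x y] M by (smt (verit) UNIV_I mem_cball mult_left_mono)
    then show "g y \<in> cball (g x) u" using e by simp
  qed
  then have "(L * M)-lipschitz_on (cball x e) (\<lambda>x. f (g x))"
    by (rule lipschitz_on_compose2[OF lipschitz_on_subset[OF g subset_UNIV] lipschitz_on_subset[OF L]])
  then show "\<exists>u>0. \<exists>L. L-lipschitz_on (cball x u) (\<lambda>x. f (g x))" using e by blast
qed

lemma locally_lipschitz_diff:
  assumes f: "locally_lipschitz f" and g: "locally_lipschitz g"
  shows "locally_lipschitz (\<lambda>x. f x - g x)"
  unfolding locally_lipschitz_def
proof
  fix x
  from f obtain u L where u: "u > 0" and L: "L-lipschitz_on (cball x u) f"
    unfolding locally_lipschitz_def by blast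
  from g obtain u' L' where u': "u' > 0" and L': "L'-lipschitz_on (cball x u') g"
    unfolding locally_lipschitz_def by blast
  have "(L + L')-lipschitz_on (cball x (min u u')) (\<lambda>x. f x - g x)"
    by (intro lipschitz_on_diff lipschitz_on_subset[OF L] lipschitz_on_subset[OF L']) auto
  then show "\<exists>u>0. \<exists>L. L-lipschitz_on (cball x u) (\<lambda>x. f x - g x)"
    using u u' by (intro exI[of _ "min u u'"]) auto
qed

lemma locally_lipschitz_const: "locally_lipschitz (\<lambda>x. c)"
  unfolding locally_lipschitz_def
proof
  fix x :: real
  have "0-lipschitz_on (cball x 1) (\<lambda>_. c)" by (rule lipschitz_on_constant)
  then show "\<exists>u>0. \<exists>L. L-lipschitz_on (cball x u) (\<lambda>_. c)" using zero_less_one by blast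
qed

lemma locally_lipschitz_continuous:
  assumes "locally_lipschitz f"
  shows "continuous_on UNIV f"
proof -
  have "isCont f x" for x
  proof -
    from assms obtain u L where u: "u > 0" and L: "L-lipschitz_on (cball x u) f"
      unfolding locally_lipschitz_def by blast
    from lipschitz_on_continuous_on[OF L] u show ?thesis
      by (intro continuous_on_interior[of "cball x u"]) auto
  qed
  then show ?thesis by (simp add: continuous_at_imp_continuous_on)
qed

section \<open>The model density\<close>

text \<open>Since \<open>x\<close> and \<open>D - x\<close> add up to at most
  \<open>D_max K N\<close>, the argument nearer to \<open>D\<close> gives the larger generalised
  sine. The maximum replaces the case distinction in proofs of continuity and contraction.\<close>

lemma h_model_eq:
  assumes N: "1 < N" and D: "0 < D" "ereal D \<le> D_max K N" and x: "0 \<le> x" "x \<le> D"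
  shows "h_model K N D x = max (s_fun (K / (N - 1)) x) (s_fun (K / (N - 1)) (D - x)) powr (N - 1)"
proof -
  have "s_fun (K / (N - 1)) x \<le> s_fun (K / (N - 1)) (D - x)" if "x \<le> D / 2"
    using that assms by (intro s_fun_mono) auto
  moreover have "s_fun (K / (N - 1)) (D - x) \<le> s_fun (K / (N - 1)) x" if "D / 2 \<le> x"
    using that assms by (intro s_fun_mono) auto
  ultimately show ?thesis using x unfolding h_model_def by (auto simp: max_def)
qed

lemma h_model_reflect: "h_model K N D (D - x) = h_model K N D x"
  unfolding h_model_def by (cases "x = D / 2") (auto simp: not_le)

lemma h_model_nonneg: "0 \<le> h_model K N D x"
  unfolding h_model_def by auto

lemma h_model_borel [measurable]: "h_model K N D \<in> borel_measurable borel"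
  unfolding h_model_def by measurable

text \<open>The model may jump at the ends of \<open>{0..D}\<close>, but inside this interval it
  agrees with the continuous expression \<open>h_model_eq\<close>, so compactness gives
  integrability.\<close>

lemma integrable_mult_h_model:
  assumes N: "1 < N" and D: "0 < D" "ereal D \<le> D_max K N" and f: "continuous_on UNIV f"
  shows "integrable lborel (\<lambda>x. f x * h_model K N D x)"
proof -
  let ?s = "s_fun (K / (N - 1))"
  let ?g = "\<lambda>x. f x * max (?s x) (?s (D - x)) powr (N - 1)"
  have "0 \<le> ?s x" if "x \<in> {0..D}" for x
    using that N D by (intro s_fun_nonneg) (auto intro: order_trans[rotated])
  then have "continuous_on {0..D} ?g"
    using N by (intro continuous_intros continuous_on_powr' continuous_on_subset[OF f] continuous_on_s_fun
        continuous_on_compose2[OF continuous_on_s_fun[of UNIV]]) (auto simp: max_def)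
  then have "set_integrable lborel {0..D} ?g" by (rule borel_integrable_atLeastAtMost')
  then have "integrable lborel (\<lambda>x. indicator {0..D} x *\<^sub>R ?g x)" unfolding set_integrable_def .
  also have "(\<lambda>x. indicator {0..D} x *\<^sub>R ?g x) = (\<lambda>x. f x * h_model K N D x)"
  proof
    fix x
    show "indicator {0..D} x *\<^sub>R ?g x = f x * h_model K N D x"
    proof (cases "x \<in> {0..D}")
      case True
      then have "h_model K N D x = max (?s x) (?s (D - x)) powr (N - 1)"
        by (intro h_model_eq[OF N D]) auto
      with True show ?thesis by simp
    next
      case False
      then show ?thesis using D by (auto simp: h_model_def)
    qed
  qed
  finally show ?thesis .
qed

section \<open>Reflection about the midpoint and one-sided inequalities for the model\<close>

lemma nn_integral_symmetric:
  fixes G :: "real \<Rightarrow> ennreal"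
  assumes [measurable]: "G \<in> borel_measurable borel"
    and sym: "\<And>x. G (D - x) = G x" and out: "\<And>x. D < x \<Longrightarrow> G x = 0"
  shows "(\<integral>\<^sup>+x. G x \<partial>lborel) = 2 * (\<integral>\<^sup>+x\<in>{D/2<..<D}. G x \<partial>lborel)"
proof -
  have "(\<integral>\<^sup>+x. G x \<partial>lborel) = (\<integral>\<^sup>+x. G x * indicator {..<D/2} x + G x * indicator {D/2<..} x \<partial>lborel)"
    using AE_lborel_singleton[of "D/2"]
    by (intro nn_integral_cong_AE) (auto elim!: eventually_mono simp: indicator_def)
  also have "\<dots> = (\<integral>\<^sup>+x. G x * indicator {..<D/2} x \<partial>lborel) + (\<integral>\<^sup>+x. G x * indicator {D/2<..} x \<partial>lborel)"
    by (intro nn_integral_add) auto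
  also have "(\<integral>\<^sup>+x. G x * indicator {..<D/2} x \<partial>lborel)
      = (\<integral>\<^sup>+x. G (D + -1 * x) * indicator {..<D/2} (D + -1 * x) \<partial>lborel)"
    by (subst nn_integral_real_affine[where c="-1" and t=D]) auto
  also have "\<dots> = (\<integral>\<^sup>+x. G x * indicator {D/2<..} x \<partial>lborel)"
    by (intro nn_integral_cong) (auto simp: sym indicator_def)
  also have "(\<integral>\<^sup>+x. G x * indicator {D/2<..} x \<partial>lborel) = (\<integral>\<^sup>+x\<in>{D/2<..<D}. G x \<partial>lborel)"
    using AE_lborel_singleton[of D]
    by (intro nn_integral_cong_AE) (auto elim!: eventually_mono simp: indicator_def out)
  finally show ?thesis by (simp add: mult_2)
qed

text \<open>The odd reflection \<open>v\<close> of \<open>u\<close> about \<open>D / 2\<close> has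
  mean zero against the symmetric model, hence competes in the infimum defining the gap. Its
  numerator and denominator are twice the integrals over the right half, and the factor 2
  cancels.\<close>

lemma h_model_half_poincare:
  assumes N: "1 < N" and D: "0 < D" "ereal D \<le> D_max K N"
    and u: "locally_lipschitz u" and u0: "u (D / 2) = 0"
  shows "spectral_gap (h_model K N D)
      * (\<integral>\<^sup>+x\<in>{D/2<..<D}. ennreal ((u x)\<^sup>2 * s_fun (K / (N - 1)) x powr (N - 1)) \<partial>lborel)
    \<le> (\<integral>\<^sup>+x\<in>{D/2<..<D}. ennreal ((deriv u x)\<^sup>2 * s_fun (K / (N - 1)) x powr (N - 1)) \<partial>lborel)"
    (is "?lam * ?A \<le> ?B")
proof (cases "?A = 0")
  case False
  define h where "h = h_model K N D"
  \<comment> \<open>On either side of \<open>D / 2\<close> one of the two terms is frozen at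
    \<open>u (D / 2) = 0\<close>. Clamping the argument by a 1-Lipschitz map yields the odd function
    without any gluing argument.\<close>
  define v where "v x = u (max x (D / 2)) - u (max (D - x) (D / 2))" for x
  have v: "locally_lipschitz v"
    unfolding v_def
    by (intro locally_lipschitz_diff locally_lipschitz_compose[OF u, where M=1] lipschitz_onI)
      (auto simp: dist_real_def max_def)
  note v_cont = locally_lipschitz_continuous[OF v]
  have v_borel [measurable]: "v \<in> borel_measurable borel" "deriv v \<in> borel_measurable borel"
    using v_cont by (auto intro: borel_measurable_continuous_onI borel_measurable_deriv)
  have h_borel [measurable]: "h \<in> borel_measurable borel" by (simp add: h_def)
  have v_odd: "v (D - x) = - v x" for x by (simp add: v_def)
  have v_right: "v x = u x" if "D / 2 \<le> x" for x
    using that u0 by (cases "x = D / 2") (auto simp: v_def max_def)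
  have h_right: "h x = s_fun (K / (N - 1)) x powr (N - 1)" if "D / 2 < x" "x < D" for x
    using that D by (simp add: h_def h_model_def)
  have h_out: "h x = 0" if "D < x" for x using that D by (simp add: h_def h_model_def)
  \<comment> \<open>Applied at \<open>x\<close> and at \<open>D - x\<close>, the inequality gives
    evenness of the absolute derivative, also at points of non-differentiability.\<close>
  have deriv_le: "\<bar>deriv v x\<bar> \<le> \<bar>deriv v (D - x)\<bar>" for x
    using abs_deriv_affine_le[of "-1" "-1" v D 0 x] by (simp add: v_odd)
  have deriv_even: "\<bar>deriv v (D - x)\<bar>\<^sup>2 = \<bar>deriv v x\<bar>\<^sup>2" for x
    using deriv_le[of x] deriv_le[of "D - x"] by simp
  have deriv_right: "deriv v x = deriv u x" if "D / 2 < x" for x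
  proof (rule deriv_cong_ev)
    show "eventually (\<lambda>x. v x = u x) (nhds x)"
      using that eventually_nhds_in_open[of "{D / 2<..}" x]
      by (auto elim!: eventually_mono simp: v_right)
  qed simp
  have "(\<integral>\<^sup>+x. ennreal ((v x)\<^sup>2 * h x) \<partial>lborel) = 2 * (\<integral>\<^sup>+x\<in>{D/2<..<D}. ennreal ((v x)\<^sup>2 * h x) \<partial>lborel)"
    by (intro nn_integral_symmetric) (auto simp: v_odd h_def h_model_reflect h_out[unfolded h_def])
  also have "(\<integral>\<^sup>+x\<in>{D/2<..<D}. ennreal ((v x)\<^sup>2 * h x) \<partial>lborel) = ?A"
    by (intro nn_integral_cong) (auto simp: indicator_def v_right h_right)
  finally have A: "(\<integral>\<^sup>+x. ennreal ((v x)\<^sup>2 * h x) \<partial>lebesgue) = 2 * ?A"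
    by (simp add: nn_integral_completion)
  have "(\<integral>\<^sup>+x. ennreal (\<bar>deriv v x\<bar>\<^sup>2 * h x) \<partial>lborel)
      = 2 * (\<integral>\<^sup>+x\<in>{D/2<..<D}. ennreal (\<bar>deriv v x\<bar>\<^sup>2 * h x) \<partial>lborel)"
  proof (intro nn_integral_symmetric)
    show "ennreal (\<bar>deriv v (D - x)\<bar>\<^sup>2 * h (D - x)) = ennreal (\<bar>deriv v x\<bar>\<^sup>2 * h x)" for x
      unfolding deriv_even by (simp add: h_def h_model_reflect)
  qed (auto simp: h_out)
  also have "(\<integral>\<^sup>+x\<in>{D/2<..<D}. ennreal (\<bar>deriv v x\<bar>\<^sup>2 * h x) \<partial>lborel) = ?B"
    by (intro nn_integral_cong) (auto simp: indicator_def deriv_right h_right)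
  finally have B: "(\<integral>\<^sup>+x. ennreal (\<bar>deriv v x\<bar>\<^sup>2 * h x) \<partial>lebesgue) = 2 * ?B"
    by (simp add: nn_integral_completion)
  have "integrable lborel (\<lambda>x. (v x)\<^sup>2 * h x)"
    unfolding h_def using N D by (intro integrable_mult_h_model continuous_intros v_cont)
  then have fin: "2 * ?A < \<infinity>"
    unfolding A[symmetric] nn_integral_completion
    by (auto simp: integrable_iff_bounded h_def h_model_nonneg abs_mult)
  have int: "integrable lborel (\<lambda>x. v x * h x)"
    unfolding h_def using N D by (intro integrable_mult_h_model v_cont)
  have "(\<integral>x. v x * h x \<partial>lborel) = (\<integral>x. v (D + -1 * x) * h (D + -1 * x) \<partial>lborel)"
    by (subst lborel_integral_real_affine[where c="-1" and t=D]) auto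
  also have "\<dots> = - (\<integral>x. v x * h x \<partial>lborel)"
    by (simp add: v_odd h_def h_model_reflect)
  finally have "(\<integral>x. v x * h x \<partial>lborel) = 0" by simp
  with int have "has_bochner_integral lebesgue (\<lambda>x. v x * h x) 0"
    by (simp add: has_bochner_integral_iff integrable_completion integral_completion)
  moreover have "0 < 2 * ?A"
    using False by (simp add: ennreal_zero_less_mult_iff zero_less_iff_neq_zero)
  ultimately have "?lam \<le> 2 * ?B / (2 * ?A)"
    unfolding spectral_gap_def A[symmetric] B[symmetric] h_def[symmetric]
    using v fin by (intro INF_lower) (simp add: A)
  then have "?lam * (2 * ?A) \<le> 2 * ?B / (2 * ?A) * (2 * ?A)" by (rule mult_right_mono) simp
  also have "\<dots> = 2 * ?B"
    using fin \<open>0 < 2 * ?A\<close> by (subst ennreal_divide_times, subst ennreal_divide_self) auto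
  finally have "2 * (?lam * ?A) \<le> 2 * ?B" by (simp add: mult.left_commute)
  then show ?thesis by (subst (asm) ennreal_mult_le_mult_iff) auto
qed simp

text \<open>The function frozen at \<open>u y\<close> beyond \<open>y\<close> still vanishes at
  \<open>D / 2\<close>. Its derivative is zero past \<open>y\<close>, while the integral of its
  square only grows when the domain is extended from \<open>y\<close> to \<open>D\<close>. The
  family over all \<open>y\<close> is the input for antitone weights.\<close>

lemma h_model_initial_poincare:
  assumes N: "1 < N" and D: "0 < D" "ereal D \<le> D_max K N"
    and u: "locally_lipschitz u" and u0: "u (D / 2) = 0" and y: "D / 2 < y" "y \<le> D"
  shows "spectral_gap (h_model K N D)
      * (\<integral>\<^sup>+x\<in>{D/2<..<y}. ennreal ((u x)\<^sup>2 * s_fun (K / (N - 1)) x powr (N - 1)) \<partial>lborel)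
    \<le> (\<integral>\<^sup>+x\<in>{D/2<..<y}. ennreal ((deriv u x)\<^sup>2 * s_fun (K / (N - 1)) x powr (N - 1)) \<partial>lborel)"
proof -
  let ?w = "\<lambda>x. s_fun (K / (N - 1)) x powr (N - 1)"
  let ?lam = "spectral_gap (h_model K N D)"
  define v where "v x = u (min x y)" for x
  have v: "locally_lipschitz v"
    unfolding v_def by (intro locally_lipschitz_compose[OF u, where M=1] lipschitz_onI)
      (auto simp: dist_real_def min_def)
  have deriv_left: "deriv v x = deriv u x" if "x < y" for x
  proof (rule deriv_cong_ev)
    show "eventually (\<lambda>x. v x = u x) (nhds x)"
      using that eventually_nhds_in_open[of "{..<y}" x]
      by (auto elim!: eventually_mono simp: v_def)
  qed simp
  have deriv_right: "deriv v x = 0" if "y < x" for x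
  proof -
    have "deriv v x = deriv (\<lambda>_. u y) x"
    proof (rule deriv_cong_ev)
      show "eventually (\<lambda>x. v x = u y) (nhds x)"
        using that eventually_nhds_in_open[of "{y<..}" x]
        by (auto elim!: eventually_mono simp: v_def)
    qed simp
    then show ?thesis by simp
  qed
  have "(\<integral>\<^sup>+x\<in>{D/2<..<y}. ennreal ((u x)\<^sup>2 * ?w x) \<partial>lborel)
      \<le> (\<integral>\<^sup>+x\<in>{D/2<..<D}. ennreal ((v x)\<^sup>2 * ?w x) \<partial>lborel)"
    using y by (intro nn_integral_mono) (auto simp: indicator_def v_def)
  then have "?lam * (\<integral>\<^sup>+x\<in>{D/2<..<y}. ennreal ((u x)\<^sup>2 * ?w x) \<partial>lborel)
      \<le> ?lam * (\<integral>\<^sup>+x\<in>{D/2<..<D}. ennreal ((v x)\<^sup>2 * ?w x) \<partial>lborel)"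
    by (rule mult_left_mono) simp
  also have "\<dots> \<le> (\<integral>\<^sup>+x\<in>{D/2<..<D}. ennreal ((deriv v x)\<^sup>2 * ?w x) \<partial>lborel)"
    using u0 y by (intro h_model_half_poincare[OF N D v]) (simp add: v_def)
  also have "\<dots> = (\<integral>\<^sup>+x\<in>{D/2<..<y}. ennreal ((deriv u x)\<^sup>2 * ?w x) \<partial>lborel)"
  proof (intro nn_integral_cong_AE)
    show "AE x in lborel. ennreal ((deriv v x)\<^sup>2 * ?w x) * indicator {D/2<..<D} x
        = ennreal ((deriv u x)\<^sup>2 * ?w x) * indicator {D/2<..<y} x"
      using AE_lborel_singleton[of y]
    proof (rule eventually_mono)
      fix x assume "x \<noteq> y"
      then show "ennreal ((deriv v x)\<^sup>2 * ?w x) * indicator {D/2<..<D} x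
        = ennreal ((deriv u x)\<^sup>2 * ?w x) * indicator {D/2<..<y} x"
        using y by (cases "x < y") (auto simp: indicator_def deriv_left deriv_right)
    qed
  qed
  finally show ?thesis .
qed

section \<open>Antitone weights\<close>

text \<open>The non-negative part of \<open>g x\<close> is the length of the set of levels
  \<open>s\<close> with \<open>0 \<le> s < g x\<close>; Tonelli then exchanges the order of
  integration.\<close>

lemma nn_integral_weight_layer_cake:
  fixes R :: "real \<Rightarrow> ennreal" and g :: "real \<Rightarrow> real"
  assumes [measurable]: "R \<in> borel_measurable borel" "g \<in> borel_measurable borel"
  shows "(\<integral>\<^sup>+x. R x * ennreal (g x) \<partial>lborel)
    = (\<integral>\<^sup>+s. (\<integral>\<^sup>+x. R x * (if 0 \<le> s \<and> s < g x then 1 else 0) \<partial>lborel) \<partial>lborel)"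
proof -
  have "R x * ennreal (g x) = (\<integral>\<^sup>+s. R x * (if 0 \<le> s \<and> s < g x then 1 else 0) \<partial>lborel)" for x
  proof -
    have "(\<integral>\<^sup>+s. R x * (if 0 \<le> s \<and> s < g x then 1 else 0) \<partial>lborel)
        = (\<integral>\<^sup>+s. R x * indicator {0..<g x} s \<partial>lborel)"
      by (intro nn_integral_cong) (auto simp: indicator_def)
    also have "\<dots> = R x * ennreal (g x)"
      by (cases "0 \<le> g x") (auto simp: nn_integral_cmult ennreal_neg)
    finally show ?thesis by simp
  qed
  then have "(\<integral>\<^sup>+x. R x * ennreal (g x) \<partial>lborel)
    = (\<integral>\<^sup>+x. (\<integral>\<^sup>+s. R x * (if 0 \<le> s \<and> s < g x then 1 else 0) \<partial>lborel) \<partial>lborel)"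
    by simp
  also have "\<dots> = (\<integral>\<^sup>+s. (\<integral>\<^sup>+x. R x * (if 0 \<le> s \<and> s < g x then 1 else 0) \<partial>lborel) \<partial>lborel)"
    by (rule lborel_pair.Fubini'[symmetric]) measurable
  finally show ?thesis .
qed

text \<open>The superlevel sets of an antitone weight are initial intervals, so an inequality between
  integrals over all initial intervals survives multiplication by the weight.\<close>

lemma nn_integral_antitone_weight_le:
  fixes P Q :: "real \<Rightarrow> ennreal" and g :: "real \<Rightarrow> real" and c :: ennreal
  assumes P [measurable]: "P \<in> borel_measurable borel" and Q [measurable]: "Q \<in> borel_measurable borel"
    and anti: "\<And>x y. a < x \<Longrightarrow> x \<le> y \<Longrightarrow> y < b \<Longrightarrow> g y \<le> g x"
    and le: "\<And>y. a < y \<Longrightarrow> y \<le> b \<Longrightarrow>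
      c * (\<integral>\<^sup>+x\<in>{a<..<y}. P x \<partial>lborel) \<le> (\<integral>\<^sup>+x\<in>{a<..<y}. Q x \<partial>lborel)"
  shows "c * (\<integral>\<^sup>+x\<in>{a<..<b}. P x * ennreal (g x) \<partial>lborel)
    \<le> (\<integral>\<^sup>+x\<in>{a<..<b}. Q x * ennreal (g x) \<partial>lborel)"
proof -
  \<comment> \<open>Extension by zero confines every superlevel set at a level
    \<open>s \<ge> 0\<close> to \<open>{a<..<b}\<close>.\<close>
  define G where "G x = (if x \<in> {a<..<b} then g x else 0)" for x
  have "mono_on {a<..<b} (\<lambda>x. - g x)" by (rule mono_onI) (use anti in auto)
  then have "(\<lambda>x. - (- g x)) \<in> borel_measurable (restrict_space borel {a<..<b})"
    by (intro borel_measurable_uminus borel_measurable_mono_on_fnc)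
  then have "g \<in> borel_measurable (restrict_space borel {a<..<b})" by simp
  then have [measurable]: "G \<in> borel_measurable borel"
    unfolding G_def by (subst (asm) measurable_restrict_space_iff[where c=0]) auto
  have eq: "(\<integral>\<^sup>+x\<in>{a<..<b}. R x * ennreal (g x) \<partial>lborel) = (\<integral>\<^sup>+x. R x * ennreal (G x) \<partial>lborel)"
    for R :: "real \<Rightarrow> ennreal"
    by (intro nn_integral_cong) (auto simp: G_def indicator_def)
  have level: "c * (\<integral>\<^sup>+x. P x * (if 0 \<le> s \<and> s < G x then 1 else 0) \<partial>lborel)
      \<le> (\<integral>\<^sup>+x. Q x * (if 0 \<le> s \<and> s < G x then 1 else 0) \<partial>lborel)" for s
  proof (cases "0 \<le> s \<and> (\<exists>x. s < G x)")
    case True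
    define A where "A = {x. s < G x}"
    have sub: "A \<subseteq> {a<..<b}" using True by (auto simp: A_def G_def split: if_splits)
    have ne: "A \<noteq> {}" using True by (auto simp: A_def)
    have bdd: "bdd_above A" using sub by (intro bdd_aboveI[of _ b]) auto
    \<comment> \<open>By antitonicity the superlevel set \<open>A\<close> contains all points of
      \<open>{a<..<y}\<close>, and it can differ from that interval only in the null set formed by
      \<open>y\<close>.\<close>
    define y where "y = Sup A"
    obtain z where z: "z \<in> A" using ne by blast
    have y: "a < y" "y \<le> b"
    proof -
      have "a < z" using z sub by auto
      also have "z \<le> y" unfolding y_def using z bdd by (rule cSup_upper)
      finally show "a < y" .
      show "y \<le> b" unfolding y_def using ne sub by (intro cSup_least) auto
    qed
    have A1: "x \<in> A" if "a < x" "x < y" for x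
    proof -
      have "\<exists>z\<in>A. x < z" using that less_cSup_iff[OF ne bdd, of x] by (simp add: y_def)
      then obtain z where "z \<in> A" "x < z" by blast
      then show ?thesis using sub that anti[of x z] by (auto simp: A_def G_def subset_iff split: if_splits)
    qed
    have A2: "x \<le> y" "a < x" if "x \<in> A" for x
      using that sub cSup_upper[OF _ bdd] by (auto simp: y_def)
    have A: "x \<in> A \<longleftrightarrow> x \<in> {a<..<y}" if "x \<noteq> y" for x
      using A1[of x] A2[of x] that by auto
    have int: "(\<integral>\<^sup>+x. R x * (if 0 \<le> s \<and> s < G x then 1 else 0) \<partial>lborel)
        = (\<integral>\<^sup>+x\<in>{a<..<y}. R x \<partial>lborel)" for R :: "real \<Rightarrow> ennreal"
      using AE_lborel_singleton[of y] True A
      by (intro nn_integral_cong_AE) (auto elim!: eventually_mono simp: indicator_def A_def)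
    show ?thesis unfolding int using y by (rule le)
  next
    case False
    then have "(if 0 \<le> s \<and> s < G x then 1 else 0) = (0 :: ennreal)" for x by auto
    then show ?thesis by simp
  qed
  have "c * (\<integral>\<^sup>+x. P x * ennreal (G x) \<partial>lborel)
      = (\<integral>\<^sup>+s. c * (\<integral>\<^sup>+x. P x * (if 0 \<le> s \<and> s < G x then 1 else 0) \<partial>lborel) \<partial>lborel)"
    by (subst nn_integral_weight_layer_cake) (simp_all add: nn_integral_cmult)
  also have "\<dots> \<le> (\<integral>\<^sup>+x. Q x * ennreal (G x) \<partial>lborel)"
    unfolding nn_integral_weight_layer_cake[OF Q \<open>G \<in> borel_measurable borel\<close>]
    by (intro nn_integral_mono level)
  finally show ?thesis unfolding eq .
qed

text \<open>The affine map \<open>x \<mapsto> e + q * x\<close> carries the right half of the model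
  interval onto \<open>I\<close>; a negative \<open>q\<close> serves the left half of a support.
  Along it, \<open>h\<close> is the model density \<open>w\<close> times an antitone quotient
  \<open>g\<close>. As \<open>\<bar>q\<bar> \<le> 1\<close>, the chain rule can only shrink the
  derivative, which is the favourable direction.\<close>

lemma half_poincare:
  assumes N: "1 < N" and D: "0 < D" "ereal D \<le> D_max K N"
    and f: "locally_lipschitz f" and q: "q \<noteq> 0" "\<bar>q\<bar> \<le> 1"
    and h [measurable]: "h \<in> borel_measurable lebesgue"
    and anti: "\<And>x y. 0 < x \<Longrightarrow> x \<le> y \<Longrightarrow> y < D \<Longrightarrow>
      h (e + q * y) / s_fun (K / (N - 1)) y powr (N - 1) \<le> h (e + q * x) / s_fun (K / (N - 1)) x powr (N - 1)"
    and I: "\<And>x. e + q * x \<in> I \<longleftrightarrow> x \<in> {D/2<..<D}" "I \<in> sets borel"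
  shows "spectral_gap (h_model K N D) * (\<integral>\<^sup>+x\<in>I. ennreal ((f x - f (e + q * (D/2)))\<^sup>2 * h x) \<partial>lebesgue)
    \<le> (\<integral>\<^sup>+x\<in>I. ennreal (\<bar>deriv f x\<bar>\<^sup>2 * h x) \<partial>lebesgue)"
proof -
  let ?lam = "spectral_gap (h_model K N D)"
  define w where "w x = s_fun (K / (N - 1)) x powr (N - 1)" for x
  define c where "c = f (e + q * (D/2))"
  \<comment> \<open>Subtracting \<open>c\<close> makes \<open>u\<close> vanish at
    \<open>D / 2\<close>; the factor 1 and the form \<open>+ - c\<close> match
    \<open>abs_deriv_affine_le\<close>.\<close>
  define u where "u x = 1 * f (e + q * x) + - c" for x
  define g where "g x = h (e + q * x) / w x" for x
  have w: "w x > 0" if "x \<in> {D/2<..<D}" for x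
  proof -
    have "0 < x" "ereal x < ereal D" using that D by auto
    then have "0 < s_fun (K / (N - 1)) x" by (intro s_fun_pos[OF N _ order.strict_trans2[OF _ D(2)]])
    then show ?thesis unfolding w_def by simp
  qed
  have w_borel [measurable]: "w \<in> borel_measurable borel" unfolding w_def by measurable
  have u: "locally_lipschitz u"
    unfolding u_def add_uminus_conv_diff mult_1
    by (intro locally_lipschitz_diff locally_lipschitz_const locally_lipschitz_compose[OF f, where M="\<bar>q\<bar>"] lipschitz_onI)
      (auto simp: dist_real_def abs_mult[symmetric] algebra_simps)
  have [measurable]: "u \<in> borel_measurable borel" "deriv u \<in> borel_measurable borel"
      "f \<in> borel_measurable borel" "deriv f \<in> borel_measurable borel"
    using locally_lipschitz_continuous[OF u] locally_lipschitz_continuous[OF f]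
    by (auto intro: borel_measurable_continuous_onI borel_measurable_deriv)
  have f_leb [measurable]: "f \<in> borel_measurable lebesgue" "deriv f \<in> borel_measurable lebesgue"
    by (auto intro: measurable_completion)
  have I_leb [measurable]: "I \<in> sets lebesgue" using I(2) by (simp add: sets_completionI_sets)
  have "?lam * (\<integral>\<^sup>+x\<in>{D/2<..<D}. ennreal ((u x)\<^sup>2 * w x) * ennreal (g x) \<partial>lborel)
      \<le> (\<integral>\<^sup>+x\<in>{D/2<..<D}. ennreal ((deriv u x)\<^sup>2 * w x) * ennreal (g x) \<partial>lborel)"
  proof (rule nn_integral_antitone_weight_le)
    show "?lam * (\<integral>\<^sup>+x\<in>{D/2<..<y}. ennreal ((u x)\<^sup>2 * w x) \<partial>lborel)
        \<le> (\<integral>\<^sup>+x\<in>{D/2<..<y}. ennreal ((deriv u x)\<^sup>2 * w x) \<partial>lborel)"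
      if "D/2 < y" "y \<le> D" for y
      unfolding w_def using that by (intro h_model_initial_poincare N D u) (simp_all add: u_def c_def)
    show "g y \<le> g x" if "D/2 < x" "x \<le> y" "y < D" for x y
      unfolding g_def w_def using that D by (intro anti) auto
  qed measurable
  also have "(\<integral>\<^sup>+x\<in>{D/2<..<D}. ennreal ((u x)\<^sup>2 * w x) * ennreal (g x) \<partial>lborel)
      = (\<integral>\<^sup>+x. ennreal ((f (e + q * x) - c)\<^sup>2 * h (e + q * x)) * indicator I (e + q * x) \<partial>lborel)"
  proof (intro nn_integral_cong)
    fix x
    show "ennreal ((u x)\<^sup>2 * w x) * ennreal (g x) * indicator {D/2<..<D} x
      = ennreal ((f (e + q * x) - c)\<^sup>2 * h (e + q * x)) * indicator I (e + q * x)"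
    proof (cases "x \<in> {D/2<..<D}")
      case True
      with w[OF True] I(1)[of x] show ?thesis
        by (simp add: u_def g_def ennreal_mult'[symmetric])
    qed (use I(1)[of x] in simp)
  qed
  also have "(\<integral>\<^sup>+x\<in>{D/2<..<D}. ennreal ((deriv u x)\<^sup>2 * w x) * ennreal (g x) \<partial>lborel)
      \<le> (\<integral>\<^sup>+x. ennreal (\<bar>deriv f (e + q * x)\<bar>\<^sup>2 * h (e + q * x)) * indicator I (e + q * x) \<partial>lborel)"
  proof (intro nn_integral_mono)
    fix x
    have "\<bar>deriv u x\<bar> \<le> \<bar>deriv f (e + q * x)\<bar>"
      unfolding u_def using q by (intro abs_deriv_affine_le) auto
    then have "(deriv u x)\<^sup>2 \<le> \<bar>deriv f (e + q * x)\<bar>\<^sup>2" by (simp add: abs_le_square_iff)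
    then show "ennreal ((deriv u x)\<^sup>2 * w x) * ennreal (g x) * indicator {D/2<..<D} x
      \<le> ennreal (\<bar>deriv f (e + q * x)\<bar>\<^sup>2 * h (e + q * x)) * indicator I (e + q * x)"
    proof (cases "x \<in> {D/2<..<D}")
      case True
      have "ennreal ((deriv u x)\<^sup>2 * w x) * ennreal (g x) = ennreal ((deriv u x)\<^sup>2) * ennreal (h (e + q * x))"
        using w[OF True] by (simp add: g_def ennreal_mult'[symmetric])
      also have "\<dots> \<le> ennreal (\<bar>deriv f (e + q * x)\<bar>\<^sup>2) * ennreal (h (e + q * x))"
        using \<open>(deriv u x)\<^sup>2 \<le> _\<close> by (intro mult_right_mono ennreal_leI) auto
      finally show ?thesis using True I(1)[of x] by (simp add: ennreal_mult')
    qed (use I(1)[of x] in simp)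
  qed
  finally have le: "?lam * (\<integral>\<^sup>+x. ennreal ((f (e + q * x) - c)\<^sup>2 * h (e + q * x)) * indicator I (e + q * x) \<partial>lebesgue)
      \<le> (\<integral>\<^sup>+x. ennreal (\<bar>deriv f (e + q * x)\<bar>\<^sup>2 * h (e + q * x)) * indicator I (e + q * x) \<partial>lebesgue)"
    by (simp add: nn_integral_completion)
  \<comment> \<open>Undoing the substitution produces the same Jacobian \<open>\<bar>q\<bar>\<close>
    on both sides.\<close>
  have "?lam * (\<integral>\<^sup>+x\<in>I. ennreal ((f x - c)\<^sup>2 * h x) \<partial>lebesgue)
      = ennreal \<bar>q\<bar> * (?lam * (\<integral>\<^sup>+x. ennreal ((f (e + q * x) - c)\<^sup>2 * h (e + q * x)) * indicator I (e + q * x) \<partial>lebesgue))"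
    by (subst nn_integral_real_affine_lebesgue[where c=q and t=e])
      (use q in \<open>auto simp: mult.left_commute\<close>)
  also have "\<dots> \<le> ennreal \<bar>q\<bar> * (\<integral>\<^sup>+x. ennreal (\<bar>deriv f (e + q * x)\<bar>\<^sup>2 * h (e + q * x)) * indicator I (e + q * x) \<partial>lebesgue)"
    by (intro mult_left_mono le) simp
  also have "\<dots> = (\<integral>\<^sup>+x\<in>I. ennreal (\<bar>deriv f x\<bar>\<^sup>2 * h x) \<partial>lebesgue)"
    by (subst (2) nn_integral_real_affine_lebesgue[where c=q and t=e]) (use q in auto)
  finally show ?thesis unfolding c_def .
qed

section \<open>Supports of MCP densities\<close>

lemma density_supp_iff:
  assumes [measurable]: "h \<in> borel_measurable lebesgue"
  shows "x \<in> density_supp h \<longleftrightarrow> (\<forall>U. open U \<and> x \<in> U \<longrightarrow> (\<integral>\<^sup>+y\<in>U. ennreal (h y) \<partial>lebesgue) > 0)"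
  unfolding density_supp_def by (auto simp: emeasure_density)

lemma closed_density_supp: "closed (density_supp h)"
proof -
  have "- density_supp h
      = \<Union>{U. open U \<and> \<not> 0 < emeasure (density lebesgue (\<lambda>y. ennreal (h y))) U}"
    unfolding density_supp_def by blast
  then have "open (- density_supp h)" by (simp add: open_Union)
  then show ?thesis by (simp add: closed_def)
qed

text \<open>The complement of the support is a union of open sets without mass; by Lindelof
  countably many of them suffice, so the exceptional sets add up to a null set.\<close>

lemma AE_density_supp:
  assumes h [measurable]: "h \<in> borel_measurable lebesgue"
  shows "AE x in lebesgue. x \<notin> density_supp h \<longrightarrow> h x \<le> 0"
proof -
  define F where "F = {U :: real set. open U \<and> (\<integral>\<^sup>+y\<in>U. ennreal (h y) \<partial>lebesgue) = 0}"
  obtain F' where F': "F' \<subseteq> F" "countable F'" "\<Union>F' = \<Union>F"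
    using Lindelof[of F] by (auto simp: F_def)
  have "AE x in lebesgue. x \<in> U \<longrightarrow> h x \<le> 0" if "U \<in> F'" for U
  proof -
    have "open U" and 0: "(\<integral>\<^sup>+y\<in>U. ennreal (h y) \<partial>lebesgue) = 0" using that F' by (auto simp: F_def)
    then have [measurable]: "U \<in> sets lebesgue" by (simp add: borel_open sets_completionI_sets)
    have "AE x in lebesgue. ennreal (h x) * indicator U x = 0"
      using 0 by (subst (asm) nn_integral_0_iff_AE) auto
    then show ?thesis by (auto elim!: eventually_mono simp: indicator_def ennreal_eq_0_iff split: if_splits)
  qed
  then have "AE x in lebesgue. \<forall>U\<in>F'. x \<in> U \<longrightarrow> h x \<le> 0"
    using F'(2) by (subst AE_ball_countable) auto
  moreover have "x \<in> \<Union>F'" if "x \<notin> density_supp h" for x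
    using that F'(3) unfolding density_supp_iff[OF h] F_def by (auto simp: zero_less_iff_neq_zero)
  ultimately show ?thesis by (auto elim!: eventually_mono)
qed

text \<open>The MCP inequality says nothing when \<open>h x0 = 0\<close>, and \<open>h\<close> may
  vanish at a given support point. This supplies a nearby support point from which the contraction
  is informative.\<close>

lemma density_supp_pos:
  assumes h [measurable]: "h \<in> borel_measurable lebesgue"
    and x: "x \<in> density_supp h" "open U" "x \<in> U"
  shows "\<exists>y\<in>U. y \<in> density_supp h \<and> 0 < h y"
proof (rule ccontr)
  assume neg: "\<not> ?thesis"
  have "(\<integral>\<^sup>+y\<in>U. ennreal (h y) \<partial>lebesgue) = (\<integral>\<^sup>+y. 0 \<partial>(lebesgue :: real measure))"
  proof (rule nn_integral_cong_AE)
    show "AE y in lebesgue. ennreal (h y) * indicator U y = 0"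
      using AE_density_supp[OF h]
    proof (rule eventually_mono)
      fix y assume "y \<notin> density_supp h \<longrightarrow> h y \<le> 0"
      then have "y \<in> U \<Longrightarrow> h y \<le> 0" using neg by (meson not_le)
      then show "ennreal (h y) * indicator U y = 0" by (auto simp: indicator_def ennreal_neg)
    qed
  qed
  then show False using x density_supp_iff[OF h, of x] by auto
qed

text \<open>Every neighbourhood of \<open>x\<close> meets the interval in a non-empty open set,
  which is not negligible and carries a positive density.\<close>

lemma in_density_supp_interval:
  assumes h [measurable]: "h \<in> borel_measurable lebesgue"
    and pos: "\<And>y. a < y \<Longrightarrow> y < b \<Longrightarrow> 0 < h y" and x: "a < x" "x < b"
  shows "x \<in> density_supp h"
  unfolding density_supp_iff[OF h]
proof (intro allI impI, elim conjE)
  fix U :: "real set" assume U: "open U" "x \<in> U"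
  then have [measurable]: "U \<in> sets lebesgue" by (simp add: borel_open sets_completionI_sets)
  show "0 < (\<integral>\<^sup>+y\<in>U. ennreal (h y) \<partial>lebesgue)"
  proof (rule ccontr)
    assume "\<not> ?thesis"
    then have "(\<integral>\<^sup>+y\<in>U. ennreal (h y) \<partial>lebesgue) = 0" by simp
    then have "AE y in lebesgue. ennreal (h y) * indicator U y = 0"
      by (subst (asm) nn_integral_0_iff_AE) auto
    then have "AE y in lebesgue. y \<notin> U \<inter> {a<..<b}"
    proof (rule eventually_mono)
      fix y assume "ennreal (h y) * indicator U y = 0"
      then show "y \<notin> U \<inter> {a<..<b}" using pos[of y] by (auto simp: ennreal_eq_0_iff)
    qed
    then have "negligible (U \<inter> {a<..<b})"
      unfolding negligible_iff_null_sets by (subst (asm) AE_iff_null_sets[symmetric]) auto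
    moreover have "\<not> negligible (U \<inter> {a<..<b})"
      using U x by (intro open_not_negligible) auto
    ultimately show False by simp
  qed
qed

text \<open>The function is the pointwise limit of its truncations to growing balls, each of which
  is integrable.\<close>

lemma borel_measurable_locally_integrable:
  fixes h :: "real \<Rightarrow> real"
  assumes h: "\<And>C. compact C \<Longrightarrow> h absolutely_integrable_on C"
  shows "h \<in> borel_measurable lebesgue"
proof (rule borel_measurable_LIMSEQ_real)
  show "(\<lambda>x. indicator (cball 0 (real n)) x *\<^sub>R h x) \<in> borel_measurable lebesgue" for n
    using h[of "cball 0 (real n)"] unfolding set_integrable_def by auto
  show "(\<lambda>n. indicator (cball 0 (real n)) x *\<^sub>R h x) \<longlonglongrightarrow> h x" for x
  proof (rule tendsto_eventually)
    show "\<forall>\<^sub>F n in sequentially. indicator (cball 0 (real n)) x *\<^sub>R h x = h x"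
      using eventually_ge_at_top[of "nat \<lceil>\<bar>x\<bar>\<rceil>"]
      by (rule eventually_mono) (auto simp: indicator_def; linarith)
  qed
qed

section \<open>The MCP inequality and the shape of the support\<close>

lemma MCP_density_measurable:
  assumes "MCP_density K N h"
  shows "h \<in> borel_measurable lebesgue"
  using assms unfolding MCP_density_def by (intro borel_measurable_locally_integrable) auto

text \<open>The MCP inequality parametrised by the distance \<open>y\<close> to the target
  \<open>x1\<close> instead of the time: \<open>t = 1 - y / \<bar>x1 - x0\<bar>\<close>. Below the
  maximal distance all coefficients are finite and the inequality descends to the reals.\<close>

lemma MCP_density_ge:
  assumes N: "1 < N" and h: "MCP_density K N h" and supp: "x0 \<in> density_supp h" "x1 \<in> density_supp h"
    and y: "0 < y" "y \<le> \<bar>x1 - x0\<bar>" and len: "ereal \<bar>x1 - x0\<bar> < D_max K N"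
  shows "(s_fun (K / (N - 1)) y / s_fun (K / (N - 1)) \<bar>x1 - x0\<bar>) powr (N - 1) * h x0
    \<le> h (x1 + y / \<bar>x1 - x0\<bar> * (x0 - x1))"
proof -
  let ?s = "s_fun (K / (N - 1))"
  define r where "r = \<bar>x1 - x0\<bar>"
  have r: "0 < r" using y by (simp add: r_def)
  have "ereal y < D_max K N" using y len by (meson ereal_less_eq(3) le_less_trans)
  then have s: "?s y / ?s r \<ge> 0"
    using N y(1) r len by (intro divide_nonneg_nonneg less_imp_le s_fun_pos) (auto simp: r_def)
  have nn: "0 \<le> h x" for x using h by (simp add: MCP_density_def)
  have t: "1 - y / r \<in> {0..1}" using y r by (auto simp: r_def)
  have "ennreal_powr (sigma_coeff K N (1 - (1 - y / r)) \<bar>x1 - x0\<bar>) (N - 1) * ennreal (h x0)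
      \<le> ennreal (h ((1 - y / r) * x1 + (1 - (1 - y / r)) * x0))"
    using h supp t unfolding MCP_density_def by blast
  also have "(1 - y / r) * x1 + (1 - (1 - y / r)) * x0 = x1 + y / r * (x0 - x1)"
    using r by (simp add: field_simps)
  also have "sigma_coeff K N (1 - (1 - y / r)) \<bar>x1 - x0\<bar> = ennreal (?s y / ?s r)"
    using len r unfolding sigma_coeff_def r_def[symmetric] by (simp add: not_le)
  also have "ennreal_powr (ennreal (?s y / ?s r)) (N - 1) = ennreal ((?s y / ?s r) powr (N - 1))"
    using s by (simp add: ennreal_powr_def)
  finally show ?thesis
    unfolding r_def[symmetric] using nn by (simp add: ennreal_mult''[symmetric])
qed

text \<open>At \<open>t = 0\<close> the intermediate point is \<open>x0\<close> itself while the
  coefficient is infinite, so a positive finite \<open>h x0\<close> would dominate infinity.\<close>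

lemma MCP_density_far:
  assumes N: "1 < N" and h: "MCP_density K N h" and supp: "x0 \<in> density_supp h" "x1 \<in> density_supp h"
    and len: "D_max K N \<le> ereal \<bar>x1 - x0\<bar>"
  shows "h x0 = 0"
proof (rule ccontr)
  assume "h x0 \<noteq> 0"
  then have pos: "0 < h x0" using h by (simp add: MCP_density_def less_le)
  have "ennreal_powr (sigma_coeff K N (1 - 0) \<bar>x1 - x0\<bar>) (N - 1) * ennreal (h x0)
      \<le> ennreal (h (0 * x1 + (1 - 0) * x0))"
    using h supp unfolding MCP_density_def by (metis atLeastAtMost_iff order_refl zero_le_one)
  then show False using pos len
    by (simp add: sigma_coeff_def ennreal_powr_def ennreal_top_mult top_unique)
qed

text \<open>Contraction towards the left end \<open>a\<close> spreads positivity over the whole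
  interval, and the blow-up of the coefficient bounds its length, in analogy with the Bonnet-Myers
  theorem.\<close>

lemma MCP_density_supp:
  assumes N: "1 < N" and h: "MCP_density K N h" and bdd: "bounded (density_supp h)"
  obtains a b where "a < b" "density_supp h = {a..b}" "ereal (b - a) \<le> D_max K N"
proof -
  let ?S = "density_supp h"
  let ?s = "s_fun (K / (N - 1))"
  note hm = MCP_density_measurable[OF h]
  obtain x y where xy: "x \<in> ?S" "y \<in> ?S" "x < y"
    using h unfolding MCP_density_def by (metis linorder_neqE_linordered_idom)
  have comp: "compact ?S" using bdd closed_density_supp by (simp add: compact_eq_bounded_closed)
  obtain a where a: "a \<in> ?S" "\<And>z. z \<in> ?S \<Longrightarrow> a \<le> z"
    using compact_attains_inf[OF comp] xy by blast
  obtain b where b: "b \<in> ?S" "\<And>z. z \<in> ?S \<Longrightarrow> z \<le> b"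
    using compact_attains_sup[OF comp] xy by blast
  have "a < b" using a(2)[OF xy(1)] b(2)[OF xy(2)] xy(3) by simp
  moreover have "?S = {a..b}"
  proof
    show "?S \<subseteq> {a..b}" using a b by auto
    show "{a..b} \<subseteq> ?S"
    proof
      fix z assume "z \<in> {a..b}"
      then consider "z = a" | "z = b" | "a < z" "z < b" by force
      then show "z \<in> ?S"
      proof cases
        case 3
        \<comment> \<open>A source of positive density to the right of \<open>z\<close>: contracting
          it towards \<open>a\<close> makes \<open>h\<close> positive on all of
          \<open>(a, x0)\<close>, which contains \<open>z\<close>.\<close>
        obtain x0 where x0: "x0 \<in> {z<..}" "x0 \<in> ?S" "0 < h x0"
          using density_supp_pos[OF hm b(1), of "{z<..}"] 3 by auto
        have len: "ereal \<bar>a - x0\<bar> < D_max K N"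
          using MCP_density_far[OF N h x0(2) a(1)] x0(3)
          by (cases "D_max K N \<le> ereal \<bar>a - x0\<bar>") (auto simp: not_le)
        have "0 < h w" if "a < w" "w < x0" for w
        proof -
          have r: "\<bar>a - x0\<bar> = x0 - a" using that by simp
          have "0 < ?s (w - a)" "0 < ?s (x0 - a)"
            using that len unfolding r by (auto intro!: s_fun_pos N intro: le_less_trans[rotated])
          then have "0 < (?s (w - a) / ?s (x0 - a)) powr (N - 1) * h x0" using x0 by simp
          also have "\<dots> \<le> h (a + (w - a) / (x0 - a) * (x0 - a))"
            using MCP_density_ge[OF N h x0(2) a(1), of "w - a"] that len unfolding r by simp
          finally show ?thesis using that by simp
        qed
        then show ?thesis using 3 x0 by (intro in_density_supp_interval[OF hm, of a x0]) auto
      qed (use a b in simp_all)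
    qed
  qed
  moreover have "ereal (b - a) \<le> D_max K N"
  proof (rule ccontr)
    assume neg: "\<not> ?thesis"
    then obtain d where d: "D_max K N = ereal d" "d < b - a" by (auto simp: D_max_def split: if_splits)
    \<comment> \<open>If the support were longer than \<open>d\<close>, there would be points of
      positive density near \<open>a\<close> at distance more than \<open>d\<close> from
      \<open>b\<close>.\<close>
    obtain x0 where x0: "x0 \<in> {..<b - d}" "x0 \<in> ?S" "0 < h x0"
      using density_supp_pos[OF hm a(1), of "{..<b - d}"] d by auto
    have "h x0 = 0" using x0(1) d by (intro MCP_density_far[OF N h x0(2) b(1)]) simp
    with x0 show False by simp
  qed
  ultimately show ?thesis by (rule that)
qed

text \<open>Contracting \<open>e + q * y\<close> towards \<open>e\<close> compares the two values of
  \<open>h\<close> through generalised sines at \<open>\<bar>q\<bar> * x\<close> and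
  \<open>\<bar>q\<bar> * y\<close>. \<open>s_fun_scale\<close> replaces these by sines at
  \<open>x\<close> and \<open>y\<close>, and here the alternative
  \<open>K \<le> 0 \<or> \<bar>q\<bar> = 1\<close> enters.\<close>

lemma MCP_density_antitone:
  assumes N: "1 < N" and D: "0 < D" "ereal D \<le> D_max K N"
    and h: "MCP_density K N h" and supp: "e \<in> density_supp h" "e + q * y \<in> density_supp h"
    and q: "K \<le> 0 \<or> \<bar>q\<bar> = 1" "q \<noteq> 0" "\<bar>q\<bar> \<le> 1" and xy: "0 < x" "x \<le> y" "y < D"
  shows "h (e + q * y) / s_fun (K / (N - 1)) y powr (N - 1) \<le> h (e + q * x) / s_fun (K / (N - 1)) x powr (N - 1)"
proof -
  let ?s = "s_fun (K / (N - 1))"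
  let ?c = "\<bar>q\<bar>"
  have less: "ereal z < D_max K N" if "z \<le> y" for z
    using that xy D by (meson ereal_less_eq(3) ereal_less(2) le_less_trans less_ereal.simps(1) order.strict_trans2)
  have cy: "?c * y \<le> y" "?c * x \<le> x" using q xy by (simp_all add: mult_left_le_one_le)
  then have "?c * x \<le> y" using xy by linarith
  note cy = cy this
  have pos: "0 < ?s x" "0 < ?s y" "0 < ?s (?c * x)" "0 < ?s (?c * y)"
    using xy cy q by (auto intro!: s_fun_pos N less)
  have r: "\<bar>e - (e + q * y)\<bar> = ?c * y" using xy by (simp add: abs_mult)
  have nn: "0 \<le> h z" for z using h by (simp add: MCP_density_def)
  have "K / (N - 1) \<le> 0 \<or> ?c = 1" using q N by (auto simp: divide_nonpos_pos)
  then have "?s x * ?s (?c * y) \<le> ?s (?c * x) * ?s y" using q xy by (intro s_fun_scale) auto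
  then have "?s x / ?s y \<le> ?s (?c * x) / ?s (?c * y)" using pos by (simp add: field_simps)
  then have "(?s x / ?s y) powr (N - 1) * h (e + q * y)
      \<le> (?s (?c * x) / ?s (?c * y)) powr (N - 1) * h (e + q * y)"
    using pos N nn by (intro mult_right_mono powr_mono2) auto
  also have "\<dots> \<le> h (e + ?c * x / (?c * y) * (e + q * y - e))"
    using MCP_density_ge[OF N h supp(2,1), of "?c * x"] xy q less[of "?c * y"] cy unfolding r
    by (auto intro: mult_left_mono)
  also have "e + ?c * x / (?c * y) * (e + q * y - e) = e + q * x" using q xy by simp
  finally have "(?s x / ?s y) powr (N - 1) * h (e + q * y) \<le> h (e + q * x)" .
  then show ?thesis using pos by (simp add: powr_divide field_simps)
qed

text \<open>The midpoint value \<open>f m\<close> takes the place of the mean of \<open>f\<close>: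
  \<open>\<integral> (f - c)\<^sup>2 h\<close> is smallest when \<open>c\<close> is the mean, and each half of the support obeys the
  one-sided inequality with vanishing boundary value at \<open>m\<close>.\<close>

lemma spectral_gap_h_model_le:
  assumes N: "1 < N" and D: "0 < D" "ereal D \<le> D_max K N"
    and h: "MCP_density K N h" and supp: "density_supp h = {a..b}" "a < b"
    and len: "b - a = D \<or> K \<le> 0 \<and> b - a \<le> D"
  shows "spectral_gap (h_model K N D) \<le> spectral_gap h"
  unfolding spectral_gap_def[of h]
proof (rule INF_greatest, safe)
  fix f
  assume f: "locally_lipschitz f" and mean: "has_bochner_integral lebesgue (\<lambda>x. f x * h x) 0"
    and pos: "0 < (\<integral>\<^sup>+x. ennreal ((f x)\<^sup>2 * h x) \<partial>lebesgue)"
    and fin: "(\<integral>\<^sup>+x. ennreal ((f x)\<^sup>2 * h x) \<partial>lebesgue) < \<infinity>"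
  let ?lam = "spectral_gap (h_model K N D)"
  \<comment> \<open>The scale that maps an interval of length \<open>D\<close> onto the support; it
    equals 1 when \<open>K > 0\<close>.\<close>
  define q where "q = (b - a) / D"
  define c where "c = f ((a + b) / 2)"
  have q: "0 < q" "q \<le> 1" "K \<le> 0 \<or> q = 1" using len D supp(2) by (auto simp: q_def)
  have qD: "q * D = b - a" using D by (simp add: q_def)
  have nn: "0 \<le> h x" for x using h by (simp add: MCP_density_def)
  note [measurable] = MCP_density_measurable[OF h]
  have [measurable]: "f \<in> borel_measurable lebesgue" "deriv f \<in> borel_measurable lebesgue"
    using locally_lipschitz_continuous[OF f]
    by (auto intro!: measurable_completion borel_measurable_continuous_onI borel_measurable_deriv)
  have left: "a + q * y \<in> {a..b}" and right: "b + - q * y \<in> {a..b}" if "0 < y" "y < D" for y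
  proof -
    have "0 \<le> q * y" "q * y \<le> q * D" using that q by (auto intro: mult_left_mono)
    then show "a + q * y \<in> {a..b}" "b + - q * y \<in> {a..b}" using qD by auto
  qed
  have qI: "q * x < b - a \<longleftrightarrow> x < D" "(b - a) / 2 < q * x \<longleftrightarrow> D / 2 < x" for x
    unfolding qD[symmetric] using q by (auto simp: mult_less_cancel_left_pos[of q "D/2" x, symmetric])
  \<comment> \<open>The right half is parametrised by the rescaled distance from \<open>a\<close>,
    and the left half below by that from \<open>b\<close>. Thus both correspond to the right half
    \<open>(D/2, D)\<close> of the model, and both midpoints map to
    \<open>(a + b) / 2\<close>.\<close>
  have half1: "?lam * (\<integral>\<^sup>+x\<in>{(a+b)/2<..<b}. ennreal ((f x - f (a + q * (D/2)))\<^sup>2 * h x) \<partial>lebesgue)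
      \<le> (\<integral>\<^sup>+x\<in>{(a+b)/2<..<b}. ennreal (\<bar>deriv f x\<bar>\<^sup>2 * h x) \<partial>lebesgue)"
  proof (rule half_poincare[OF N D f])
    show "h (a + q * y) / s_fun (K / (N - 1)) y powr (N - 1) \<le> h (a + q * x) / s_fun (K / (N - 1)) x powr (N - 1)"
      if "0 < x" "x \<le> y" "y < D" for x y
      using that q left[of y] supp by (intro MCP_density_antitone[OF N D h]) auto
    show "a + q * x \<in> {(a+b)/2<..<b} \<longleftrightarrow> x \<in> {D/2<..<D}" for x
      using qI[of x] by (auto simp: field_simps)
  qed (use q in auto)
  have half2: "?lam * (\<integral>\<^sup>+x\<in>{a<..<(a+b)/2}. ennreal ((f x - f (b + - q * (D/2)))\<^sup>2 * h x) \<partial>lebesgue)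
      \<le> (\<integral>\<^sup>+x\<in>{a<..<(a+b)/2}. ennreal (\<bar>deriv f x\<bar>\<^sup>2 * h x) \<partial>lebesgue)"
  proof (rule half_poincare[OF N D f])
    show "h (b + - q * y) / s_fun (K / (N - 1)) y powr (N - 1) \<le> h (b + - q * x) / s_fun (K / (N - 1)) x powr (N - 1)"
      if "0 < x" "x \<le> y" "y < D" for x y
      using that q right[of y] supp by (intro MCP_density_antitone[OF N D h]) auto
    show "b + - q * x \<in> {a<..<(a+b)/2} \<longleftrightarrow> x \<in> {D/2<..<D}" for x
      using qI[of x] by (auto simp: field_simps)
  qed (use q in auto)
  have mid: "a + q * (D/2) = (a + b) / 2" "b + - q * (D/2) = (a + b) / 2"
    using qD by (auto simp: field_simps)
  have split: "(\<integral>\<^sup>+x. ennreal (F x * h x) \<partial>lebesgue)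
      = (\<integral>\<^sup>+x\<in>{(a+b)/2<..<b}. ennreal (F x * h x) \<partial>lebesgue) + (\<integral>\<^sup>+x\<in>{a<..<(a+b)/2}. ennreal (F x * h x) \<partial>lebesgue)"
    if [measurable]: "F \<in> borel_measurable lebesgue" for F
  proof -
    have [measurable]: "{u<..<v} \<in> sets lebesgue" for u v :: real by simp
    have ae: "AE x in lebesgue. x \<noteq> z" for z :: real
      by (intro AE_completion AE_lborel_singleton)
    have "AE x in lebesgue. x \<noteq> a \<and> x \<noteq> b \<and> x \<noteq> (a + b) / 2 \<and> (x \<notin> density_supp h \<longrightarrow> h x \<le> 0)"
      using AE_density_supp[OF MCP_density_measurable[OF h]] ae[of a] ae[of b] ae[of "(a + b) / 2"]
      by eventually_elim auto
    then have "(\<integral>\<^sup>+x. ennreal (F x * h x) \<partial>lebesgue)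
      = (\<integral>\<^sup>+x. ennreal (F x * h x) * indicator {(a+b)/2<..<b} x + ennreal (F x * h x) * indicator {a<..<(a+b)/2} x \<partial>lebesgue)"
    proof (intro nn_integral_cong_AE, elim eventually_mono, elim conjE)
      fix x assume x: "x \<noteq> a" "x \<noteq> b" "x \<noteq> (a + b) / 2" "x \<notin> density_supp h \<longrightarrow> h x \<le> 0"
      consider "(a + b) / 2 < x" "x < b" | "a < x" "x < (a + b) / 2" | "x \<notin> {a..b}"
        using x(1,2,3) by force
      then show "ennreal (F x * h x) = ennreal (F x * h x) * indicator {(a+b)/2<..<b} x
          + ennreal (F x * h x) * indicator {a<..<(a+b)/2} x"
      proof cases
        case 3
        then have "h x = 0" using x(4) nn[of x] supp(1) by (simp add: order.antisym)
        then show ?thesis by simp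
      qed (use supp(2) in \<open>auto simp: indicator_def\<close>)
    qed
    also have "\<dots> = (\<integral>\<^sup>+x\<in>{(a+b)/2<..<b}. ennreal (F x * h x) \<partial>lebesgue)
        + (\<integral>\<^sup>+x\<in>{a<..<(a+b)/2}. ennreal (F x * h x) \<partial>lebesgue)"
      by (intro nn_integral_add) measurable
    finally show ?thesis .
  qed
  have "integrable lebesgue (\<lambda>x. (f x)\<^sup>2 * h x)"
    using fin nn by (intro integrableI_nonneg) auto
  \<comment> \<open>This is \<open>(f x - c)\<^sup>2 * h x\<close> without the non-negative term
    \<open>c\<^sup>2 * h x\<close>; its integral is that of \<open>(f x)\<^sup>2 * h x\<close>,
    because \<open>f\<close> has mean zero. The maximum with 0 below allows the passage to
    non-negative integrals.\<close>
  then have int: "integrable lebesgue (\<lambda>x. (f x)\<^sup>2 * h x - 2 * c * (f x * h x))"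
    and val: "(\<integral>x. (f x)\<^sup>2 * h x - 2 * c * (f x * h x) \<partial>lebesgue) = (\<integral>x. (f x)\<^sup>2 * h x \<partial>lebesgue)"
    using mean by (auto simp: has_bochner_integral_iff)
  have "(\<integral>\<^sup>+x. ennreal ((f x)\<^sup>2 * h x) \<partial>lebesgue) = ennreal (\<integral>x. (f x)\<^sup>2 * h x \<partial>lebesgue)"
    using nn \<open>integrable lebesgue (\<lambda>x. (f x)\<^sup>2 * h x)\<close> by (intro nn_integral_eq_integral) auto
  also have "\<dots> \<le> ennreal (\<integral>x. max 0 ((f x)\<^sup>2 * h x - 2 * c * (f x * h x)) \<partial>lebesgue)"
    unfolding val[symmetric] using int by (intro ennreal_leI integral_mono integrable_max) auto
  also have "\<dots> = (\<integral>\<^sup>+x. ennreal (max 0 ((f x)\<^sup>2 * h x - 2 * c * (f x * h x))) \<partial>lebesgue)"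
    using int by (intro nn_integral_eq_integral[symmetric] integrable_max) auto
  also have "\<dots> \<le> (\<integral>\<^sup>+x. ennreal ((f x - c)\<^sup>2 * h x) \<partial>lebesgue)"
  proof (intro nn_integral_mono ennreal_leI)
    fix x
    have "(f x - c)\<^sup>2 * h x = (f x)\<^sup>2 * h x - 2 * c * (f x * h x) + c\<^sup>2 * h x"
      by (simp add: power2_eq_square algebra_simps)
    moreover have "0 \<le> c\<^sup>2 * h x" "0 \<le> (f x - c)\<^sup>2 * h x" using nn[of x] by auto
    ultimately show "max 0 ((f x)\<^sup>2 * h x - 2 * c * (f x * h x)) \<le> (f x - c)\<^sup>2 * h x" by simp
  qed
  finally have "?lam * (\<integral>\<^sup>+x. ennreal ((f x)\<^sup>2 * h x) \<partial>lebesgue) \<le> ?lam * (\<integral>\<^sup>+x. ennreal ((f x - c)\<^sup>2 * h x) \<partial>lebesgue)"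
    by (rule mult_left_mono) simp
  also have "\<dots> \<le> (\<integral>\<^sup>+x. ennreal (\<bar>deriv f x\<bar>\<^sup>2 * h x) \<partial>lebesgue)"
  proof -
    have m: "(\<lambda>x. (f x - c)\<^sup>2) \<in> borel_measurable lebesgue" "(\<lambda>x. \<bar>deriv f x\<bar>\<^sup>2) \<in> borel_measurable lebesgue"
      by measurable
    show ?thesis
      unfolding split[OF m(1)] split[OF m(2)] distrib_left
      using half1 half2 unfolding mid c_def[symmetric] by (rule add_mono)
  qed
  finally have "?lam * (\<integral>\<^sup>+x. ennreal ((f x)\<^sup>2 * h x) \<partial>lebesgue) / (\<integral>\<^sup>+x. ennreal ((f x)\<^sup>2 * h x) \<partial>lebesgue)
      \<le> (\<integral>\<^sup>+x. ennreal (\<bar>deriv f x\<bar>\<^sup>2 * h x) \<partial>lebesgue) / (\<integral>\<^sup>+x. ennreal ((f x)\<^sup>2 * h x) \<partial>lebesgue)"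
    by (rule divide_right_mono_ennreal)
  then show "?lam \<le> (\<integral>\<^sup>+x. ennreal (\<bar>deriv f x\<bar>\<^sup>2 * h x) \<partial>lebesgue) / (\<integral>\<^sup>+x. ennreal ((f x)\<^sup>2 * h x) \<partial>lebesgue)"
    using pos fin by (subst (asm) ennreal_mult_divide_eq) auto
qed

section \<open>Sharpness\<close>

text \<open>Ptolemy's identity is applied to each branch of the maximum. The terms discarded are
  \<open>s (z - x0) * s (D - x1)\<close> and \<open>s (z - x0) * s x1\<close>, products of
  non-negative values.\<close>

lemma s_fun_max_contraction:
  assumes N: "1 < N" and D: "0 < D" "ereal D \<le> D_max K N"
    and x: "0 \<le> x0" "x0 \<le> z" "z \<le> x1" "x1 \<le> D"
  defines "s \<equiv> s_fun (K / (N - 1))"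
  shows "s (x1 - z) * max (s x0) (s (D - x0)) \<le> s (x1 - x0) * max (s z) (s (D - z))"
proof -
  have nn: "0 \<le> s y" if "0 \<le> y" "y \<le> D" for y
    unfolding s_def using that N D by (intro s_fun_nonneg) (auto intro: order_trans[rotated])
  have "s (x1 - z) * s (D - x0) = s (x1 - x0) * s (D - z) - s (z - x0) * s (D - x1)"
    using s_fun_ptolemy[of _ x1 x0 D z] unfolding s_def by (simp add: algebra_simps)
  also have "\<dots> \<le> s (x1 - x0) * s (D - z)" using x by (simp add: nn)
  also have "\<dots> \<le> s (x1 - x0) * max (s z) (s (D - z))" using x by (intro mult_left_mono nn) auto
  finally have 1: "s (x1 - z) * s (D - x0) \<le> s (x1 - x0) * max (s z) (s (D - z))" .
  have "s (x1 - z) * s x0 = s (x1 - x0) * s z - s (z - x0) * s x1"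
    using s_fun_ptolemy[of _ x1 x0 0 z] unfolding s_def by (simp add: algebra_simps)
  also have "\<dots> \<le> s (x1 - x0) * s z" using x by (simp add: nn)
  also have "\<dots> \<le> s (x1 - x0) * max (s z) (s (D - z))" using x by (intro mult_left_mono nn) auto
  finally have 2: "s (x1 - z) * s x0 \<le> s (x1 - x0) * max (s z) (s (D - z))" .
  from 1 2 show ?thesis by (simp add: max_def[of "s x0" "s (D - x0)"])
qed

text \<open>Raising the contraction inequality for the maximum to the power \<open>N - 1\<close>
  gives the case \<open>x0 < x1\<close>; the reflection \<open>x \<mapsto> D - x\<close> reduces the
  other case to it.\<close>

lemma h_model_contraction:
  assumes N: "1 < N" and D: "0 < D" "ereal D \<le> D_max K N"
    and x: "x0 \<in> {0..D}" "x1 \<in> {0..D}" "x0 \<noteq> x1" and t: "t \<in> {0..1}"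
    and len: "ereal \<bar>x1 - x0\<bar> < D_max K N"
  defines "s \<equiv> s_fun (K / (N - 1))"
  shows "(s ((1 - t) * \<bar>x1 - x0\<bar>) / s \<bar>x1 - x0\<bar>) powr (N - 1) * h_model K N D x0
    \<le> h_model K N D (t * x1 + (1 - t) * x0)"
proof -
  have increasing: "(s ((1 - t) * (x1 - x0)) / s (x1 - x0)) powr (N - 1) * h_model K N D x0
      \<le> h_model K N D (t * x1 + (1 - t) * x0)"
    if x: "0 \<le> x0" "x0 < x1" "x1 \<le> D" and len: "ereal (x1 - x0) < D_max K N" for x0 x1
  proof -
    define z where "z = t * x1 + (1 - t) * x0"
    define m where "m y = max (s y) (s (D - y))" for y
    have "0 \<le> t * (x1 - x0)" "t * (x1 - x0) \<le> 1 * (x1 - x0)"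
      using x t by (auto intro!: mult_right_mono)
    then have z: "x0 \<le> z" "z \<le> x1" by (auto simp: z_def algebra_simps)
    have zt: "(1 - t) * (x1 - x0) = x1 - z" by (simp add: z_def algebra_simps)
    have s_nn: "0 \<le> s y" if "0 \<le> y" "y \<le> D" for y
      unfolding s_def using that N D by (intro s_fun_nonneg) (auto intro: order_trans[rotated])
    have s_pos: "0 < s (x1 - x0)" unfolding s_def using x len by (intro s_fun_pos N) auto
    have m_nn: "0 \<le> m x0" using s_nn[of x0] x by (simp add: m_def)
    have "s (x1 - z) * m x0 \<le> s (x1 - x0) * m z"
      unfolding m_def s_def using x z by (intro s_fun_max_contraction N D) auto
    then have "s (x1 - z) / s (x1 - x0) * m x0 \<le> m z" using s_pos by (simp add: field_simps)
    moreover have nn: "0 \<le> s (x1 - z) / s (x1 - x0)" using s_nn[of "x1 - z"] s_pos x z by simp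
    ultimately have "(s (x1 - z) / s (x1 - x0) * m x0) powr (N - 1) \<le> m z powr (N - 1)"
      using N by (intro powr_mono2 mult_nonneg_nonneg m_nn) simp_all
    then have "(s (x1 - z) / s (x1 - x0)) powr (N - 1) * m x0 powr (N - 1) \<le> m z powr (N - 1)"
      using nn m_nn by (subst (asm) powr_mult) simp_all
    then show ?thesis
      using h_model_eq[OF N D, of x0] h_model_eq[OF N D, of z] x z
      unfolding zt z_def[symmetric] m_def s_def by simp
  qed
  show ?thesis
  proof (cases "x0 < x1")
    case True
    then show ?thesis using increasing[of x0 x1] x len by simp
  next
    case False
    have "t * (D - x1) + (1 - t) * (D - x0) = D - (t * x1 + (1 - t) * x0)"
      by (simp add: algebra_simps)
    then show ?thesis
      using increasing[of "D - x0" "D - x1"] x len False by (simp add: h_model_reflect)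
  qed
qed

section \<open>The model as an extremal MCP density\<close>

lemma density_supp_h_model:
  assumes D: "0 < D"
  shows "density_supp (h_model K N D) \<subseteq> {0..D}"
proof
  fix x assume x: "x \<in> density_supp (h_model K N D)"
  have m: "h_model K N D \<in> borel_measurable lebesgue" by (intro measurable_completion) simp
  show "x \<in> {0..D}"
  proof (rule ccontr)
    assume "x \<notin> {0..D}"
    moreover have "open (- {0..D})" by (intro open_Compl closed_atLeastAtMost)
    ultimately have "open (- {0..D}) \<and> x \<in> - {0..D}" by blast
    then have "0 < (\<integral>\<^sup>+y\<in>- {0..D}. ennreal (h_model K N D y) \<partial>lebesgue)"
      using x unfolding density_supp_iff[OF m] by blast
    also have "(\<integral>\<^sup>+y\<in>- {0..D}. ennreal (h_model K N D y) \<partial>lebesgue) = (\<integral>\<^sup>+y. 0 \<partial>(lebesgue :: real measure))"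
      using D by (intro nn_integral_cong) (auto simp: indicator_def h_model_def)
    finally show False by simp
  qed
qed

text \<open>This makes the lower bound optimal: the models are themselves admissible. Distance zero,
  distances below the maximal one, and the maximal distance are treated separately, according to the
  three branches of \<open>sigma_coeff\<close>.\<close>

lemma MCP_density_h_model:
  assumes N: "1 < N" and D: "0 < D" "ereal D \<le> D_max K N"
  shows "MCP_density K N (h_model K N D)"
  unfolding MCP_density_def
proof (intro conjI)
  let ?h = "h_model K N D"
  let ?s = "s_fun (K / (N - 1))"
  have m: "?h \<in> borel_measurable lebesgue" by (intro measurable_completion) simp
  show "\<forall>x. 0 \<le> ?h x" by (simp add: h_model_nonneg)
  have "integrable lebesgue ?h"
    using integrable_mult_h_model[OF N D, of "\<lambda>_. 1"] by (simp add: integrable_completion)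
  then show "\<forall>C. compact C \<longrightarrow> ?h absolutely_integrable_on C"
    unfolding set_integrable_def
    by (auto intro!: integrable_mult_indicator fmeasurableD lmeasurable_compact simp del: real_scaleR_def)
  have "x \<in> density_supp ?h" if "0 < x" "x < D" for x
  proof (rule in_density_supp_interval[OF m _ that])
    fix y assume y: "0 < y" "y < D"
    have "ereal y < ereal D" using y by simp
    then have "ereal y < D_max K N" using D(2) by (rule order.strict_trans2)
    then have "0 < ?s y" using N y by (intro s_fun_pos)
    then show "0 < ?h y" using y h_model_eq[OF N D, of y] by (auto simp: max_def)
  qed
  then have "D / 3 \<in> density_supp ?h" "D / 2 \<in> density_supp ?h" using D by auto
  moreover have "D / 3 \<noteq> D / 2" using D by simp
  ultimately show "\<exists>x\<in>density_supp ?h. \<exists>y\<in>density_supp ?h. x \<noteq> y" by blast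
  show "\<forall>x0\<in>density_supp ?h. \<forall>x1\<in>density_supp ?h. \<forall>t\<in>{0..1}.
     ennreal_powr (sigma_coeff K N (1 - t) \<bar>x1 - x0\<bar>) (N - 1) * ennreal (?h x0)
     \<le> ennreal (?h (t * x1 + (1 - t) * x0))"
  proof (intro ballI)
    fix x0 x1 t :: real
    assume "x0 \<in> density_supp ?h" "x1 \<in> density_supp ?h" and t: "t \<in> {0..1}"
    then have x: "x0 \<in> {0..D}" "x1 \<in> {0..D}" using density_supp_h_model[OF D(1), of K N] by blast+
    have "ereal 0 < D_max K N" using D(1) by (intro order.strict_trans2[OF _ D(2)]) simp
    then consider (far) "D_max K N \<le> ereal \<bar>x1 - x0\<bar>" | (eq) "x0 = x1" "ereal 0 < D_max K N"
      | (near) "ereal \<bar>x1 - x0\<bar> < D_max K N" "x0 \<noteq> x1"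
      by (meson not_le)
    then show "ennreal_powr (sigma_coeff K N (1 - t) \<bar>x1 - x0\<bar>) (N - 1) * ennreal (?h x0)
      \<le> ennreal (?h (t * x1 + (1 - t) * x0))"
    proof cases
      \<comment> \<open>The distance can be maximal only if \<open>D = D_max K N\<close> and the two
        points are the endpoints. There the model vanishes, and the convention
        \<open>\<infinity> * 0 = 0\<close> applies.\<close>
      case far
      have le: "ereal \<bar>x1 - x0\<bar> \<le> ereal D" using x by auto
      have "D_max K N = ereal D" using order_trans[OF far le] D(2) by (rule antisym)
      moreover have "\<bar>x1 - x0\<bar> = D" using order_trans[OF D(2) far] le by simp
      ultimately have "x0 = 0 \<or> x0 = D" "?s D = 0" using x s_fun_D_max[OF N, of D K] by auto
      then have "?h x0 = 0" using D by (auto simp: h_model_eq[OF N D])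
      then show ?thesis by simp
    next
      case eq
      have "(1 - t) powr (N - 1) * ?h x0 \<le> 1 * ?h x0"
        using t N by (intro mult_right_mono h_model_nonneg powr_le1) auto
      then show ?thesis using eq t
        by (auto simp: sigma_coeff_def ennreal_powr_def not_le algebra_simps
            ennreal_mult''[symmetric] h_model_nonneg intro!: ennreal_leI)
    next
      case near
      let ?r = "\<bar>x1 - x0\<bar>"
      have r: "0 < ?r" "?r \<le> D" using near x by auto
      have "0 < ?s ?r" using r near by (intro s_fun_pos N)
      moreover have "0 \<le> (1 - t) * ?r" "(1 - t) * ?r \<le> 1 * ?r"
        using t r by (auto intro!: mult_right_mono)
      then have "ereal ((1 - t) * ?r) \<le> ereal ?r" "0 \<le> (1 - t) * ?r" by simp_all
      then have "0 \<le> ?s ((1 - t) * ?r)"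
        by (intro s_fun_nonneg N order_trans[OF _ less_imp_le[OF near(1)]])
      ultimately have "0 \<le> ?s ((1 - t) * ?r) / ?s ?r" by simp
      then have "ennreal_powr (sigma_coeff K N (1 - t) ?r) (N - 1)
          = ennreal ((?s ((1 - t) * ?r) / ?s ?r) powr (N - 1))"
        using near r by (simp add: sigma_coeff_def ennreal_powr_def not_le)
      then show ?thesis using h_model_contraction[OF N D x near(2) t near(1)]
        by (simp add: ennreal_mult''[symmetric] h_model_nonneg ennreal_leI)
    qed
  qed
qed

lemma spectral_gap_sharp:
  fixes C :: ennreal
  assumes N: "1 < N" and D': "0 < D'" "D' \<le> D" "ereal D' \<le> D_max K N"
    and C: "\<And>h. MCP_density K N h \<Longrightarrow> bounded (density_supp h) \<Longrightarrow> diameter (density_supp h) \<le> D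
      \<Longrightarrow> C \<le> spectral_gap h"
  shows "C \<le> spectral_gap (h_model K N D')"
proof (rule C)
  show "MCP_density K N (h_model K N D')" using N D' by (intro MCP_density_h_model)
  show "bounded (density_supp (h_model K N D'))"
    using density_supp_h_model[OF D'(1)] by (rule bounded_subset[rotated]) simp
  have "diameter (density_supp (h_model K N D')) \<le> diameter {0..D'}"
    using density_supp_h_model[OF D'(1)] by (intro diameter_subset) auto
  then show "diameter (density_supp (h_model K N D')) \<le> D" using D' by simp
qed

section \<open>The spectral gap estimate and its optimality\<close>

theorem corollary4p9:
  fixes K N D :: real
  assumes "1 < N" and "0 < D"
  shows "let R = (if K \<le> 0 then spectral_gap (h_model K N D)
                  else (INF D' \<in> {D'. 0 < D' \<and> ereal D' \<le> min (ereal D) (D_max K N)}.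
                          spectral_gap (h_model K N D')))
         in (\<forall>h. MCP_density K N h \<and> bounded (density_supp h) \<and> diameter (density_supp h) \<le> D
               \<longrightarrow> spectral_gap h \<ge> R) \<and>
            (\<forall>C::ennreal.
               (\<forall>h. MCP_density K N h \<and> bounded (density_supp h) \<and> diameter (density_supp h) \<le> D
                  \<longrightarrow> spectral_gap h \<ge> C)
               \<longrightarrow> C \<le> R)"
  unfolding Let_def
proof (intro conjI allI impI, goal_cases)
  case (1 h)
  then have h: "MCP_density K N h" "bounded (density_supp h)" "diameter (density_supp h) \<le> D" by auto
  obtain a b where ab: "a < b" "density_supp h = {a..b}" "ereal (b - a) \<le> D_max K N"
    using MCP_density_supp[OF assms(1) h(1,2)] .
  have len: "b - a \<le> D" using h(3) ab(1) unfolding ab(2) by simp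
  show ?case
  proof (cases "K \<le> 0")
    case True
    then have "ereal D \<le> D_max K N" by (simp add: D_max_def)
    then have "spectral_gap (h_model K N D) \<le> spectral_gap h"
      using assms True len by (intro spectral_gap_h_model_le[OF _ _ _ h(1) ab(2,1)]) auto
    with True show ?thesis by simp
  next
    case False
    \<comment> \<open>For positive \<open>K\<close> the comparison model has exactly the length of
      the support, which is one of the lengths in the infimum.\<close>
    have "spectral_gap (h_model K N (b - a)) \<le> spectral_gap h"
      using assms ab len by (intro spectral_gap_h_model_le[OF _ _ _ h(1) ab(2,1)]) auto
    moreover have "b - a \<in> {D'. 0 < D' \<and> ereal D' \<le> min (ereal D) (D_max K N)}"
      using ab len by simp
    ultimately show ?thesis using False by (auto intro: INF_lower2[of "b - a"])
  qed
next
  case (2 C)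
  have sharp: "C \<le> spectral_gap (h_model K N D')"
    if "0 < D'" "D' \<le> D" "ereal D' \<le> D_max K N" for D'
    using 2 by (intro spectral_gap_sharp[OF assms(1) that]) blast
  show ?case
  proof (cases "K \<le> 0")
    case True
    then show ?thesis using sharp[of D] assms by (simp add: D_max_def)
  next
    case False
    then show ?thesis using sharp by (auto intro!: INF_greatest)
  qed
qed

end
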